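(* Let $i\in\{1,2\}$ and let $v_0:=\inf\{v>0:\mathbb P(\mathcal V\le v)>0\}$. If $\lim_{v\to v_0^+}u^i(v)\le-p$, then the fact that the two firms do not enter into any contract is a Stackelberg equilibrium in Situation $i$ (i.e. $u_I^i=-p$). Otherwise, if $v_1:=\sup\{v>0:\mathbb P(\mathcal V>v)>0\}<+\infty$, then the optimization problem $$w_I^i=-p\vee\sup_{v>0}\Big\{u^i(v)\,\mathbb P(\mathcal V\le v)-p\big(1-\mathbb P(\mathcal V\le v)\big)\Big\}$$ has a solution $v^\star\in(0,v_1]\cap[v_0,v_1]$ (equal to $v_1$ when $p=+\infty$), and any Stackelberg equilibrium (firm $I$ leader) for the problem with complete information and risk aversion $v^\star$ for firm $J$ is a Stackelberg equilibrium for the problem with incomplete information.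
   Context: Standing assumptions. $u>0$; $D>0$, $r_I,r_J\ge 0$, $\delta\in\mathbb R$, $x^+=\max(x,0)$. $\mu$ is a non-constant real random variable bounded from below by a finite constant $\underline\mu$, with $\mathbb E[e^{\lambda\mu}]<\infty$ for all $\lambda\in\mathbb R$. $\varphi,\psi:\mathbb R_+\to\mathbb R_+$ are $C^1$, increasing, strictly concave, $\varphi'(0)=\psi'(0)=+\infty$, $\varphi'(\infty)=\psi'(\infty)=0$, $\varphi(\infty)+\delta^+\psi(\infty)<\underline\mu$, and $(\varphi')^{-1}(x)\sim(\psi')^{-1}(x)$ as $x\to0$. $g:\mathbb R_+\to\mathbb R$ is $C^1$, increasing, strictly concave, $g'(0)=\infty$, $g'(\infty)=0$, and $\inf\{m>0:g(m)>0\}<\infty$. $b^a,b^m,b^e:\mathbb R_+\to\mathbb R_+$ are $C^1$, increasing, concave; $(b^a)'(0)>0$ (possibly infinite), $(b^a)'(\infty)=0$, $b^a(\infty)<\infty$; $(b^m)'(0)=(b^e)'(0)=\infty$, $(b^m)'(\infty)=(b^e)'(\infty)=0$. $f:\mathbb R_+\to\mathbb R$ is differentiable, increasing, strictly convex, $f'(\infty)=\infty$. $F(a)=b^a(a)-f((1+r_I)(D+a))$, and it is assumed that $F'(0)>0$ (possibly infinite). Conventions: $(\phi')^{-1}(+\infty)=0$ for $\phi=\varphi,\psi,g$; $x/0=+\infty$ for $x>0$; $(+\infty)\cdot0=0$; $x\vee y=\max(x,y)$. Incomplete information. Firm $I$ perceives firm $J$'s risk aversion as a $(0,+\infty)$-valued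 random variable $\mathcal V$ with known distribution, independent of $\mu$; $p\in\mathbb R\cup\{+\infty\}$ is the penalty firm $I$ gets if firm $J$ does not accept the contract. Firm $J$'s best responses are $e^*(\beta)=(\varphi')^{-1}\big(\frac1{(1-\beta)^+}\big)$, $m^*(\gamma)=(g')^{-1}(1/\gamma)$ and, in Situation 1, $a^*(\beta)=(\psi')^{-1}\big(\frac{1+r_J}{(\delta(1-\beta))^+}\big)$. The controls of firm $I$ are $c^1=(\alpha,\beta,\gamma)\in\mathbb R_+\times\mathbb R\times\mathbb R_+$ in Situation 1 and $c^2=(a,\alpha,\beta,\gamma)\in\mathbb R_+\times\mathbb R_+\times\mathbb R\times\mathbb R_+$ in Situation 2. Set, abbreviating $e^*=e^*(\beta)$, $a^*=a^*(\beta)$, $m^*=m^*(\gamma)$, $$\tilde I^1(c^1)=b^a(a^* )-\mathbb E\Big[e^{-u\left(b^m(m^* )-\gamma g(m^* )+b^e(e^* )+\beta\varphi(e^* )-\alpha-\beta(\mu-\delta\psi(a^* ))\right)}\Big],$$ $$\tilde I^2(c^2)=F(a)-\mathbb E\Big[e^{-u\left(b^m(m^* )-\gamma g(m^* )+b^e(e^* )+\beta\varphi(e^* )-\alpha-\beta(\mu-\delta\psi(a))\right)}\Big],$$ $$\tilde J^1(v,c^1)=-e^{v(1+r_J)(D+a^* )}\,\mathbb E\Big[e^{-v\left(\alpha+(\beta-1)(\mu-\delta\psi(a^* )-\varphi(e^* ))-e^*+\gamma g(m^* )-m^*\right)}\Big],$$ $$\tilde J^2(v,c^2)=-\mathbb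 E\Big[e^{-v\left(\alpha+(\beta-1)(\mu-\delta\psi(a)-\varphi(e^* ))-e^*+\gamma g(m^* )-m^*\right)}\Big].$$ The event that firm $J$ accepts the contract is $\mathcal A^i(c^i)=\{-\tilde J^i(\mathcal V,c^i)\le1\}$. The value of firm $I$'s problem with incomplete information is $$u_I^i=-p\vee\sup_{c^i}\Big\{\tilde I^i(c^i)\,\mathbb P(\mathcal A^i(c^i))-p\big(1-\mathbb P(\mathcal A^i(c^i))\big)\Big\},$$ the term $-p$ corresponding to not entering into any contract; a Stackelberg equilibrium for the incomplete information problem is a choice attaining $u_I^i$: either no contract (if $u_I^i=-p$), or a control $c^i$ with $\tilde I^i(c^i)\mathbb P(\mathcal A^i(c^i))-p(1-\mathbb P(\mathcal A^i(c^i)))=u_I^i$, together with firm $J$'s best responses. The value with complete information that firm $J$'s risk aversion equals $v>0$ is $u^i(v)=\sup\{\tilde I^i(c^i):\ -\tilde J^i(v,c^i)\le1\}$; a Stackelberg equilibrium for this problem (firm $I$ leader) is a control $c^i$ with $-\tilde J^i(v,c^i)\le1$ attaining this supremum, together with firm $J$'s best responses. A solution $v^\star$ of the optimization problem defining $w_I^i$ means $w_I^i=u^i(v^\star)\mathbb P(\mathcal V\le v^\star)-p(1-\mathbb P(\mathcal V\le v^\star))$. *)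

theory Defs
  imports "HOL-Probability.Probability" "HOL-Library.Landau_Symbols"
begin

section \<open>Functions on the half-line\<close>

text \<open>
  Functions on the nonnegative reals are total functions \<open>real \<Rightarrow> real\<close>, and only their
  values on \<open>{0..}\<close> matter.
\<close>

definition strictly_convex_on :: "real set \<Rightarrow> (real \<Rightarrow> real) \<Rightarrow> bool" where
  "strictly_convex_on S h \<longleftrightarrow> convex S \<and>
     (\<forall>x\<in>S. \<forall>y\<in>S. \<forall>t. x \<noteq> y \<and> 0 < t \<and> t < 1 \<longrightarrow>
        h ((1 - t) * x + t * y) < (1 - t) * h x + t * h y)"

definition strictly_concave_on :: "real set \<Rightarrow> (real \<Rightarrow> real) \<Rightarrow> bool" where
  "strictly_concave_on S h \<longleftrightarrow> strictly_convex_on S (\<lambda>x. - h x)"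

text \<open>The right derivative at 0, which may be infinite.\<close>

definition deriv_zero :: "(real \<Rightarrow> real) \<Rightarrow> ereal" where
  "deriv_zero h = Lim (at_right 0) (\<lambda>x. ereal ((h x - h 0) / x))"

text \<open>
  Continuous differentiability on \<open>{0..}\<close>, where the derivative at 0 is allowed to be infinite
  and the derivative is continuous at 0 as an extended real function. Continuity of \<open>h\<close> at 0 does
  not follow from an infinite derivative there, so it is required separately.
\<close>

definition C1_halfline :: "(real \<Rightarrow> real) \<Rightarrow> bool" where
  "C1_halfline h \<longleftrightarrow>
     continuous_on {0..} h \<and>
     (\<forall>x>0. h differentiable (at x)) \<and>
     continuous_on {0<..} (deriv h) \<and>
     ((\<lambda>x. ereal ((h x - h 0) / x)) \<longlongrightarrow> deriv_zero h) (at_right 0) \<and>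
     ((\<lambda>x. ereal (deriv h x)) \<longlongrightarrow> deriv_zero h) (at_right 0)"

definition at_infty :: "(real \<Rightarrow> real) \<Rightarrow> ereal" where
  "at_infty h = Lim at_top (\<lambda>x. ereal (h x))"

text \<open>
  The inverse of the derivative, with value 0 at \<open>\<infinity>\<close>. It is only used for functions whose
  derivative is a bijection of \<open>{0<..}\<close>, and at arguments in \<open>{0<..\<infinity>}\<close>.
\<close>

definition inv_deriv :: "(real \<Rightarrow> real) \<Rightarrow> ereal \<Rightarrow> real" where
  "inv_deriv h y = (if y = \<infinity> then 0 else the_inv_into {0<..} (deriv h) (real_of_ereal y))"

section \<open>Data and standing assumptions\<close>

record 'w contract_data =
  prob_sp :: "'w measure"
  rv_mu :: "'w \<Rightarrow> real"
  mu_lower :: real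
  rv_V :: "'w \<Rightarrow> real"
  par_u :: real
  par_D :: real
  par_rI :: real
  par_rJ :: real
  par_delta :: real
  par_p :: ereal
  fn_phi :: "real \<Rightarrow> real"
  fn_psi :: "real \<Rightarrow> real"
  fn_g :: "real \<Rightarrow> real"
  fn_ba :: "real \<Rightarrow> real"
  fn_bm :: "real \<Rightarrow> real"
  fn_be :: "real \<Rightarrow> real"
  fn_f :: "real \<Rightarrow> real"

definition fn_F :: "'w contract_data \<Rightarrow> real \<Rightarrow> real" where
  "fn_F P a = fn_ba P a - fn_f P ((1 + par_rI P) * (par_D P + a))"

locale contract_model =
  fixes P :: "'w contract_data"
  assumes prob_sp: "prob_space (prob_sp P)"
    and u_pos: "0 < par_u P"
    and D_pos: "0 < par_D P"
    and rI_nonneg: "0 \<le> par_rI P"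
    and rJ_nonneg: "0 \<le> par_rJ P"
    and p_range: "par_p P \<noteq> - \<infinity>"
    and mu_measurable: "rv_mu P \<in> borel_measurable (prob_sp P)"
    and mu_nonconst: "\<not> (\<exists>c. AE \<omega> in prob_sp P. rv_mu P \<omega> = c)"
    and mu_bounded_below: "AE \<omega> in prob_sp P. mu_lower P \<le> rv_mu P \<omega>"
    and mu_exp_moments: "\<And>t::real. integrable (prob_sp P) (\<lambda>\<omega>. exp (t * rv_mu P \<omega>))"
    and V_measurable: "rv_V P \<in> borel_measurable (prob_sp P)"
    and V_pos: "\<And>\<omega>. \<omega> \<in> space (prob_sp P) \<Longrightarrow> 0 < rv_V P \<omega>"
    and V_mu_indep: "prob_space.indep_var (prob_sp P) borel (rv_V P) borel (rv_mu P)"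
    and phi_nonneg: "\<And>x. 0 \<le> x \<Longrightarrow> 0 \<le> fn_phi P x"
    and phi_C1: "C1_halfline (fn_phi P)"
    and phi_mono: "mono_on {0..} (fn_phi P)"
    and phi_concave: "strictly_concave_on {0..} (fn_phi P)"
    and phi_deriv_zero: "deriv_zero (fn_phi P) = \<infinity>"
    and phi_deriv_infty: "(deriv (fn_phi P) \<longlongrightarrow> 0) at_top"
    and psi_nonneg: "\<And>x. 0 \<le> x \<Longrightarrow> 0 \<le> fn_psi P x"
    and psi_C1: "C1_halfline (fn_psi P)"
    and psi_mono: "mono_on {0..} (fn_psi P)"
    and psi_concave: "strictly_concave_on {0..} (fn_psi P)"
    and psi_deriv_zero: "deriv_zero (fn_psi P) = \<infinity>"
    and psi_deriv_infty: "(deriv (fn_psi P) \<longlongrightarrow> 0) at_top"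
    and phi_psi_infty: "at_infty (fn_phi P) + ereal (max (par_delta P) 0) * at_infty (fn_psi P)
                          < ereal (mu_lower P)"
    and phi_psi_equiv: "(\<lambda>x. inv_deriv (fn_phi P) (ereal x))
                          \<sim>[at_right 0] (\<lambda>x. inv_deriv (fn_psi P) (ereal x))"
    and g_C1: "C1_halfline (fn_g P)"
    and g_mono: "mono_on {0..} (fn_g P)"
    and g_concave: "strictly_concave_on {0..} (fn_g P)"
    and g_deriv_zero: "deriv_zero (fn_g P) = \<infinity>"
    and g_deriv_infty: "(deriv (fn_g P) \<longlongrightarrow> 0) at_top"
    and g_pos: "Inf (ereal ` {m. 0 < m \<and> 0 < fn_g P m}) < \<infinity>"
    and ba_nonneg: "\<And>x. 0 \<le> x \<Longrightarrow> 0 \<le> fn_ba P x"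
    and ba_C1: "C1_halfline (fn_ba P)"
    and ba_mono: "mono_on {0..} (fn_ba P)"
    and ba_concave: "concave_on {0..} (fn_ba P)"
    and ba_deriv_zero: "0 < deriv_zero (fn_ba P)"
    and ba_deriv_infty: "(deriv (fn_ba P) \<longlongrightarrow> 0) at_top"
    and ba_infty: "at_infty (fn_ba P) < \<infinity>"
    and bm_nonneg: "\<And>x. 0 \<le> x \<Longrightarrow> 0 \<le> fn_bm P x"
    and bm_C1: "C1_halfline (fn_bm P)"
    and bm_mono: "mono_on {0..} (fn_bm P)"
    and bm_concave: "concave_on {0..} (fn_bm P)"
    and bm_deriv_zero: "deriv_zero (fn_bm P) = \<infinity>"
    and bm_deriv_infty: "(deriv (fn_bm P) \<longlongrightarrow> 0) at_top"
    and be_nonneg: "\<And>x. 0 \<le> x \<Longrightarrow> 0 \<le> fn_be P x"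
    and be_C1: "C1_halfline (fn_be P)"
    and be_mono: "mono_on {0..} (fn_be P)"
    and be_concave: "concave_on {0..} (fn_be P)"
    and be_deriv_zero: "deriv_zero (fn_be P) = \<infinity>"
    and be_deriv_infty: "(deriv (fn_be P) \<longlongrightarrow> 0) at_top"
    and f_diff: "fn_f P differentiable_on {0..}"
    and f_mono: "mono_on {0..} (fn_f P)"
    and f_convex: "strictly_convex_on {0..} (fn_f P)"
    and f_deriv_infty: "filterlim (deriv (fn_f P)) at_top at_top"
    and F_deriv_zero: "0 < deriv_zero (fn_F P)"

section \<open>Controls and best responses\<close>

text \<open>
  \<open>Control1 \<alpha> \<beta> \<gamma>\<close> is a control of firm I in Situation 1, and \<open>Control2 a \<alpha> \<beta> \<gamma>\<close> one in
  Situation 2. The responses of firm J are \<open>Response1 a e m\<close> and \<open>Response2 e m\<close>.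
\<close>

datatype control = Control1 real real real | Control2 real real real real

datatype response = Response1 real real real | Response2 real real

datatype outcome = No_Contract | Contract control response

definition controls :: "nat \<Rightarrow> control set" where
  "controls i =
     (if i = 1 then {Control1 \<alpha> \<beta> \<gamma> | \<alpha> \<beta> \<gamma>. 0 \<le> \<alpha> \<and> 0 \<le> \<gamma>}
      else {Control2 a \<alpha> \<beta> \<gamma> | a \<alpha> \<beta> \<gamma>. 0 \<le> a \<and> 0 \<le> \<alpha> \<and> 0 \<le> \<gamma>})"

text \<open>
  The quotients are taken in \<^typ>\<open>ereal\<close>, where \<open>x / 0 = \<infinity>\<close> for \<open>x > 0\<close>.
\<close>

definition e_star :: "'w contract_data \<Rightarrow> real \<Rightarrow> real" where
  "e_star P \<beta> = inv_deriv (fn_phi P) (1 / ereal (max (1 - \<beta>) 0))"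

definition m_star :: "'w contract_data \<Rightarrow> real \<Rightarrow> real" where
  "m_star P \<gamma> = inv_deriv (fn_g P) (1 / ereal \<gamma>)"

definition a_star :: "'w contract_data \<Rightarrow> real \<Rightarrow> real" where
  "a_star P \<beta> = inv_deriv (fn_psi P)
     (ereal (1 + par_rJ P) / ereal (max (par_delta P * (1 - \<beta>)) 0))"

fun best_response :: "'w contract_data \<Rightarrow> control \<Rightarrow> response" where
  "best_response P (Control1 \<alpha> \<beta> \<gamma>) = Response1 (a_star P \<beta>) (e_star P \<beta>) (m_star P \<gamma>)"
| "best_response P (Control2 a \<alpha> \<beta> \<gamma>) = Response2 (e_star P \<beta>) (m_star P \<gamma>)"

section \<open>Criteria\<close>

fun crit_I :: "'w contract_data \<Rightarrow> control \<Rightarrow> real" where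
  "crit_I P (Control1 \<alpha> \<beta> \<gamma>) =
     (let e = e_star P \<beta>; a = a_star P \<beta>; m = m_star P \<gamma> in
      fn_ba P a -
      (\<integral>\<omega>. exp (- par_u P * (fn_bm P m - \<gamma> * fn_g P m + fn_be P e + \<beta> * fn_phi P e - \<alpha>
              - \<beta> * (rv_mu P \<omega> - par_delta P * fn_psi P a))) \<partial>prob_sp P))"
| "crit_I P (Control2 a \<alpha> \<beta> \<gamma>) =
     (let e = e_star P \<beta>; m = m_star P \<gamma> in
      fn_F P a -
      (\<integral>\<omega>. exp (- par_u P * (fn_bm P m - \<gamma> * fn_g P m + fn_be P e + \<beta> * fn_phi P e - \<alpha>
              - \<beta> * (rv_mu P \<omega> - par_delta P * fn_psi P a))) \<partial>prob_sp P))"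

fun crit_J :: "'w contract_data \<Rightarrow> real \<Rightarrow> control \<Rightarrow> real" where
  "crit_J P v (Control1 \<alpha> \<beta> \<gamma>) =
     (let e = e_star P \<beta>; a = a_star P \<beta>; m = m_star P \<gamma> in
      - exp (v * (1 + par_rJ P) * (par_D P + a)) *
      (\<integral>\<omega>. exp (- v * (\<alpha> + (\<beta> - 1) * (rv_mu P \<omega> - par_delta P * fn_psi P a - fn_phi P e)
              - e + \<gamma> * fn_g P m - m)) \<partial>prob_sp P))"
| "crit_J P v (Control2 a \<alpha> \<beta> \<gamma>) =
     (let e = e_star P \<beta>; m = m_star P \<gamma> in
      - (\<integral>\<omega>. exp (- v * (\<alpha> + (\<beta> - 1) * (rv_mu P \<omega> - par_delta P * fn_psi P a - fn_phi P e)
              - e + \<gamma> * fn_g P m - m)) \<partial>prob_sp P))"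

section \<open>Complete information\<close>

definition value_complete :: "'w contract_data \<Rightarrow> nat \<Rightarrow> real \<Rightarrow> ereal" where
  "value_complete P i v = (SUP c \<in> {c \<in> controls i. - crit_J P v c \<le> 1}. ereal (crit_I P c))"

definition stackelberg_complete ::
    "'w contract_data \<Rightarrow> nat \<Rightarrow> real \<Rightarrow> control \<Rightarrow> response \<Rightarrow> bool" where
  "stackelberg_complete P i v c r \<longleftrightarrow>
     c \<in> controls i \<and> - crit_J P v c \<le> 1 \<and> ereal (crit_I P c) = value_complete P i v \<and>
     r = best_response P c"

section \<open>Incomplete information\<close>

definition accept_prob :: "'w contract_data \<Rightarrow> control \<Rightarrow> real" where
  "accept_prob P c =
     measure (prob_sp P) {\<omega> \<in> space (prob_sp P). - crit_J P (rv_V P \<omega>) c \<le> 1}"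

text \<open>
  The payoff \<open>x q - p (1 - q)\<close>; in \<^typ>\<open>ereal\<close>, \<open>\<infinity> * 0 = 0\<close>.
\<close>

definition penalized :: "'w contract_data \<Rightarrow> ereal \<Rightarrow> real \<Rightarrow> ereal" where
  "penalized P x q = x * ereal q - par_p P * ereal (1 - q)"

definition payoff_incomplete :: "'w contract_data \<Rightarrow> control \<Rightarrow> ereal" where
  "payoff_incomplete P c = penalized P (ereal (crit_I P c)) (accept_prob P c)"

definition value_incomplete :: "'w contract_data \<Rightarrow> nat \<Rightarrow> ereal" where
  "value_incomplete P i = max (- par_p P) (SUP c \<in> controls i. payoff_incomplete P c)"

fun stackelberg_incomplete :: "'w contract_data \<Rightarrow> nat \<Rightarrow> outcome \<Rightarrow> bool" where
  "stackelberg_incomplete P i No_Contract \<longleftrightarrow> value_incomplete P i = - par_p P"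
| "stackelberg_incomplete P i (Contract c r) \<longleftrightarrow>
     c \<in> controls i \<and> payoff_incomplete P c = value_incomplete P i \<and> r = best_response P c"

definition V_cdf :: "'w contract_data \<Rightarrow> real \<Rightarrow> real" where
  "V_cdf P v = measure (prob_sp P) {\<omega> \<in> space (prob_sp P). rv_V P \<omega> \<le> v}"

definition v_low :: "'w contract_data \<Rightarrow> real" where
  "v_low P = Inf {v. 0 < v \<and> 0 < V_cdf P v}"

definition v_high :: "'w contract_data \<Rightarrow> ereal" where
  "v_high P = Sup (ereal ` {v. 0 < v \<and>
     0 < measure (prob_sp P) {\<omega> \<in> space (prob_sp P). v < rv_V P \<omega>}})"

definition w_objective :: "'w contract_data \<Rightarrow> nat \<Rightarrow> real \<Rightarrow> ereal" where
  "w_objective P i v = penalized P (value_complete P i v) (V_cdf P v)"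

definition w_value :: "'w contract_data \<Rightarrow> nat \<Rightarrow> ereal" where
  "w_value P i = max (- par_p P) (SUP v \<in> {0<..}. w_objective P i v)"

definition w_solutions :: "'w contract_data \<Rightarrow> nat \<Rightarrow> real set" where
  "w_solutions P i = {v. 0 < v \<and> w_objective P i v = w_value P i}"

end

theory Submission
  imports Defs
begin

text \<open>
  By Hoelder's inequality \<open>v \<mapsto> ln E[exp (v Y)] / v\<close> is nondecreasing, so a contract is accepted
  exactly by the firms J whose risk aversion lies below some threshold, and offering a contract with
  threshold \<open>v\<close> is worth at most \<open>u(v) P(V \<le> v) - p (1 - P(V \<le> v))\<close>. Hence the
  incomplete information problem reduces to maximizing this expression in \<open>v\<close>. Its maximum exists
  if \<open>u\<close> is continuous: a small increase of the fee \<open>\<alpha>\<close> makes a contract acceptable for slightly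
  larger \<open>v\<close>. For left-continuity this must be uniform over near-optimal contracts, for which it
  suffices to bound \<open>\<beta>\<close>. The bound holds because the sum of the two certainty equivalents does not
  depend on \<open>\<alpha>\<close> and, \<open>\<mu>\<close> being non-constant, tends to \<open>- \<infinity>\<close> as \<open>\<bar>\<beta>\<bar> \<rightarrow> \<infinity>\<close>.
\<close>

section \<open>Concave functions on the half-line\<close>

lemma strictly_concave_onD:
  assumes "strictly_concave_on S h" and "x \<in> S" and "y \<in> S" and "x \<noteq> y" and "0 < t" and "t < 1"
  shows "(1 - t) * h x + t * h y < h ((1 - t) * x + t * y)"
proof -
  have "- h ((1 - t) * x + t * y) < (1 - t) * - h x + t * - h y"
    using assms unfolding strictly_concave_on_def strictly_convex_on_def by blast
  then show ?thesis by simp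
qed

lemma strictly_concave_on_imp_concave_on:
  assumes "strictly_concave_on S h"
  shows "concave_on S h"
  unfolding concave_on_def
proof (rule convex_onI)
  show "convex S"
    using assms by (simp add: strictly_concave_on_def strictly_convex_on_def)
  fix t x y :: real
  assume "0 < t" "t < 1" and "x \<in> S" "y \<in> S"
  then show "- h ((1 - t) *\<^sub>R x + t *\<^sub>R y) \<le> (1 - t) * - h x + t * - h y"
    using strictly_concave_onD[OF assms, of x y t]
    by (cases "x = y") (simp_all flip: distrib_right, simp add: left_diff_distrib)
qed

lemma concave_below_tangent:
  fixes h :: "real \<Rightarrow> real"
  assumes "concave_on {0..} h" and "h differentiable (at x)" and "0 < x" and "0 \<le> y"
  shows "h y \<le> h x + deriv h x * (y - x)"
proof -
  have "(h has_real_derivative deriv h x) (at x)"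
    using assms(2) by (simp add: DERIV_deriv_iff_real_differentiable)
  then have deriv: "((\<lambda>x. - h x) has_real_derivative - deriv h x) (at x within {0..})"
    by (intro DERIV_minus) (rule DERIV_subset, auto)
  have "deriv h x * -1 * (y - x) \<le> - h y - (- h x)"
  proof (rule convex_on_imp_above_tangent[of "{0..}" "\<lambda>x. - h x" x y])
    show "convex_on {0..} (\<lambda>x. - h x)" using assms(1) by (simp add: concave_on_def)
    show "((\<lambda>x. - h x) has_real_derivative deriv h x * -1) (at x within {0..})"
      using deriv by simp
  qed (use assms in auto)
  then show ?thesis by simp
qed

text \<open>Strict concavity makes \<open>deriv h\<close> injective on the positive half-line, and
  its limits with the intermediate value theorem make every positive number a value; hence
  \<open>the_inv_into\<close> returns a genuine positive point.\<close>

lemma inv_deriv_nonneg: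
  assumes C1: "C1_halfline h" and conc: "strictly_concave_on {0..} h"
    and d0: "deriv_zero h = \<infinity>" and dinf: "(deriv h \<longlongrightarrow> 0) at_top" and y: "0 < y"
  shows "0 \<le> inv_deriv h y"
proof (cases "y = \<infinity>")
  case False
  define r where "r = real_of_ereal y"
  have r: "0 < r" using y False by (cases y) (auto simp: r_def)
  have diff: "h differentiable (at x)" if "0 < x" for x
    using C1 that by (auto simp: C1_halfline_def)
  note tangent = concave_below_tangent[OF strictly_concave_on_imp_concave_on[OF conc] diff]
  \<comment> \<open>With equal slopes, the two tangent inequalities put the chord from
    \<open>x\<close> to \<open>z\<close> on the tangent at \<open>x\<close>; but the midpoint value
    is strictly above the chord and not above the tangent.\<close>
  have neq: "deriv h x \<noteq> deriv h z" if "0 < x" "x < z" for x z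
  proof
    assume eq: "deriv h x = deriv h z"
    have "h z \<le> h x + deriv h x * (z - x)" "h x \<le> h z + deriv h x * (x - z)"
      using tangent[of x z] tangent[of z x] that eq by auto
    moreover have "h ((1 - 1/2) * x + 1/2 * z) \<le> h x + deriv h x * ((1 - 1/2) * x + 1/2 * z - x)"
      by (rule tangent) (use that in auto)
    moreover have "(1 - 1/2) * h x + 1/2 * h z < h ((1 - 1/2) * x + 1/2 * z)"
      by (rule strictly_concave_onD[OF conc]) (use that in auto)
    ultimately show False by (simp add: field_simps)
  qed
  have "inj_on (deriv h) {0<..}"
    by (rule linorder_inj_onI') (use neq in auto)
  moreover have "r \<in> deriv h ` {0<..}"
  proof -
    have "((\<lambda>x. ereal (deriv h x)) \<longlongrightarrow> \<infinity>) (at_right 0)"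
      using C1 d0 by (simp add: C1_halfline_def)
    then have "\<forall>\<^sub>F x in at_right 0. ereal r < ereal (deriv h x)"
      by (rule order_tendstoD) simp
    then obtain b where b: "0 < b" "\<And>x. 0 < x \<Longrightarrow> x < b \<Longrightarrow> r < deriv h x"
      unfolding eventually_at_right_field by auto
    have "\<forall>\<^sub>F x in at_top. deriv h x < r"
      using dinf r by (rule order_tendstoD)
    then obtain c where c: "\<And>x. c \<le> x \<Longrightarrow> deriv h x < r"
      unfolding eventually_at_top_linorder by auto
    have "\<exists>x. b/2 \<le> x \<and> x \<le> max c b \<and> deriv h x = r"
    proof (rule IVT2')
      show "continuous_on {b/2..max c b} (deriv h)"
        using C1 b(1) unfolding C1_halfline_def
        by (auto elim!: continuous_on_subset)
    qed (use b c[of "max c b"] in \<open>auto intro: less_imp_le\<close>)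
    then show ?thesis using b(1) by force
  qed
  ultimately have "the_inv_into {0<..} (deriv h) r \<in> {0<..}"
    by (intro the_inv_into_into) auto
  then show ?thesis using False by (simp add: inv_deriv_def r_def)
qed (simp add: inv_deriv_def)

text \<open>\<open>Lim\<close> carries information only if the limit exists; monotonicity provides
  it, as the supremum over the half-line.\<close>

lemma le_at_infty:
  assumes mono: "mono_on {0..} h" and x: "0 \<le> x"
  shows "ereal (h x) \<le> at_infty h"
proof -
  have lim: "((\<lambda>x. ereal (h x)) \<longlongrightarrow> (SUP y\<in>{0..}. ereal (h y))) at_top"
  proof (rule order_tendstoI)
    fix a assume "a < (SUP y\<in>{0..}. ereal (h y))"
    then obtain y where y: "0 \<le> y" "a < ereal (h y)" by (auto simp: less_SUP_iff)
    show "\<forall>\<^sub>F x in at_top. a < ereal (h x)"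
      using eventually_ge_at_top[of y]
    proof eventually_elim
      case (elim x)
      then have "h y \<le> h x" using y mono by (auto intro: mono_onD)
      then show ?case using y(2) by (auto intro: less_le_trans)
    qed
  next
    fix a assume a: "(SUP y\<in>{0..}. ereal (h y)) < a"
    show "\<forall>\<^sub>F x in at_top. ereal (h x) < a"
      using eventually_ge_at_top[of 0]
    proof eventually_elim
      case (elim x)
      then show ?case by (intro le_less_trans[OF _ a] SUP_upper) auto
    qed
  qed
  have "at_infty h = (SUP y\<in>{0..}. ereal (h y))"
    unfolding at_infty_def by (rule tendsto_Lim[OF _ lim]) simp
  then show ?thesis using x by (auto intro: SUP_upper)
qed

text \<open>The tangent at a point of slope below 1 dominates \<open>h\<close>; minus the identity
  it is decreasing, hence largest at 0.\<close>

lemma concave_minus_id_bounded_above: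
  assumes "C1_halfline h" and "concave_on {0..} h" and "(deriv h \<longlongrightarrow> 0) at_top"
  shows "\<exists>C. \<forall>x\<ge>0. h x - x \<le> C"
proof -
  have "\<forall>\<^sub>F x in at_top. deriv h x < 1 \<and> 0 < x"
    using order_tendstoD(2)[OF assms(3), of 1] eventually_gt_at_top[of 0]
    by (intro eventually_conj) simp_all
  then obtain b where b: "deriv h b < 1" "0 < b"
    by (auto dest: eventually_happens)
  have "h x - x \<le> h b - deriv h b * b" if "0 \<le> x" for x
  proof -
    have "h x \<le> h b + deriv h b * (x - b)"
      by (rule concave_below_tangent) (use assms b that in \<open>auto simp: C1_halfline_def\<close>)
    moreover have "deriv h b * x \<le> x" using b that mult_right_mono[of "deriv h b" 1 x] by simp
    ultimately show ?thesis by (simp add: algebra_simps)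
  qed
  then show ?thesis by blast
qed

section \<open>Cumulant generating functions\<close>

definition cgf :: "'a measure \<Rightarrow> ('a \<Rightarrow> real) \<Rightarrow> real \<Rightarrow> real" where
  "cgf M X t = ln (\<integral>\<omega>. exp (t * X \<omega>) \<partial>M)"

locale exp_moments = prob_space M for M :: "'a measure" +
  fixes X :: "'a \<Rightarrow> real"
  assumes X_measurable [measurable]: "X \<in> borel_measurable M"
    and exp_integrable: "\<And>t. integrable M (\<lambda>\<omega>. exp (t * X \<omega>))"
begin

lemma mgf_pos: "0 < (\<integral>\<omega>. exp (t * X \<omega>) \<partial>M)"
proof -
  have "(\<integral>\<omega>. 0 \<partial>M) < (\<integral>\<omega>. exp (t * X \<omega>) \<partial>M)"
    by (rule integral_less_AE_space) (simp_all add: exp_integrable emeasure_space_1)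
  then show ?thesis by simp
qed

lemma exp_cgf: "exp (cgf M X t) = (\<integral>\<omega>. exp (t * X \<omega>) \<partial>M)"
  by (simp add: cgf_def mgf_pos)

lemma cgf_0 [simp]: "cgf M X 0 = 0"
  by (simp add: cgf_def prob_space)

lemma integrable_X: "integrable M X"
proof (rule Bochner_Integration.integrable_bound)
  show "integrable M (\<lambda>\<omega>. exp (1 * X \<omega>) + exp (- 1 * X \<omega>))"
    using exp_integrable by (intro Bochner_Integration.integrable_add)
  have "\<bar>x\<bar> \<le> exp x + exp (- x)" for x :: real
    using exp_ge_add_one_self[of x] exp_ge_add_one_self[of "- x"] exp_gt_zero[of x] exp_gt_zero[of "- x"]
    by linarith
  then show "AE \<omega> in M. norm (X \<omega>) \<le> norm (exp (1 * X \<omega>) + exp (- 1 * X \<omega>))"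
    by (intro AE_I2) (auto intro!: order_trans[OF _ abs_ge_self])
qed measurable

text \<open>Hoelder's inequality is obtained by integrating the convexity inequality of \<open>exp\<close> for the
  normalised exponents \<open>s X - cgf s\<close> and \<open>t X - cgf t\<close>.\<close>

lemma convex_on_cgf: "convex_on UNIV (cgf M X)"
proof (rule convex_onI)
  fix r s t :: real
  assume r: "0 < r" "r < 1"
  define c where "c = (1 - r) * cgf M X s + r * cgf M X t"
  have "exp (((1 - r) * s + r * t) * x - c)
      \<le> (1 - r) * (exp (s * x) * exp (- cgf M X s)) + r * (exp (t * x) * exp (- cgf M X t))" for x
  proof -
    have "exp ((1 - r) *\<^sub>R (s * x - cgf M X s) + r *\<^sub>R (t * x - cgf M X t))
        \<le> (1 - r) * exp (s * x - cgf M X s) + r * exp (t * x - cgf M X t)"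
      using r by (intro convex_onD[OF exp_convex]) simp_all
    moreover have "((1 - r) * s + r * t) * x - c
        = (1 - r) *\<^sub>R (s * x - cgf M X s) + r *\<^sub>R (t * x - cgf M X t)"
      by (simp add: c_def algebra_simps)
    ultimately show ?thesis by (simp add: exp_diff exp_minus divide_inverse)
  qed
  then have "(\<integral>\<omega>. exp (((1 - r) * s + r * t) * X \<omega>) * exp (- c) \<partial>M)
      \<le> (\<integral>\<omega>. (1 - r) * (exp (s * X \<omega>) * exp (- cgf M X s))
            + r * (exp (t * X \<omega>) * exp (- cgf M X t)) \<partial>M)"
    by (intro integral_mono Bochner_Integration.integrable_add integrable_mult_right
        integrable_mult_left exp_integrable) (simp add: exp_diff exp_minus divide_inverse)
  also have "\<dots> = 1"
    by (simp add: exp_integrable exp_cgf[symmetric] exp_minus)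
  finally have "exp (cgf M X ((1 - r) * s + r * t) - c) \<le> 1"
    by (simp add: exp_cgf[symmetric] exp_diff exp_minus divide_inverse)
  then show "cgf M X ((1 - r) *\<^sub>R s + r *\<^sub>R t) \<le> (1 - r) * cgf M X s + r * cgf M X t"
    by (simp add: c_def)
qed simp

lemma continuous_on_cgf: "continuous_on UNIV (cgf M X)"
  using convex_on_cgf by (rule convex_on_continuous[OF open_UNIV])

text \<open>Convexity together with the value 0 at 0. It makes \<open>cgf M X t / t\<close>
  nondecreasing for positive \<open>t\<close>.\<close>

lemma cgf_scale:
  assumes "0 \<le> r" and "r \<le> 1"
  shows "cgf M X (r * t) \<le> r * cgf M X t"
  using convex_onD[OF convex_on_cgf assms, of 0 t] by simp

text \<open>Strict Jensen inequality: exp lies above its tangent at 0 and touches it only there, so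
  equality would force \<open>X\<close> to be almost surely its mean.\<close>

lemma cgf_gt_mean:
  assumes nonconst: "\<not> (\<exists>c. AE \<omega> in M. X \<omega> = c)" and "t \<noteq> 0"
  shows "t * expectation X < cgf M X t"
proof -
  define m where "m = expectation X"
  \<comment> \<open>The gap between exp and its tangent at 0, taken at
    \<open>t * (X \<omega> - m)\<close>. The product form lets the integral be computed from
    \<open>exp_cgf\<close>.\<close>
  define h where "h \<omega> = exp (t * X \<omega>) * exp (- (t * m)) - 1 - (t * X \<omega> - t * m)" for \<omega>
  have h_eq: "h \<omega> = exp (t * X \<omega> - t * m) - 1 - (t * X \<omega> - t * m)" for \<omega>
    by (simp add: h_def exp_diff exp_minus divide_inverse)
  have h_nonneg: "0 \<le> h \<omega>" for \<omega>
    using exp_ge_add_one_self[of "t * X \<omega> - t * m"] unfolding h_eq by linarith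
  have int: "integrable M h"
    unfolding h_def using exp_integrable integrable_X by simp
  have eq: "integral\<^sup>L M h = exp (cgf M X t) * exp (- (t * m)) - 1"
    unfolding h_def using exp_integrable integrable_X by (simp add: exp_cgf m_def prob_space)
  have "integral\<^sup>L M h \<noteq> 0"
  proof
    assume "integral\<^sup>L M h = 0"
    then have "AE \<omega> in M. h \<omega> = 0"
      using integral_nonneg_eq_0_iff_AE[OF int] h_nonneg by simp
    moreover have "X \<omega> = m" if "h \<omega> = 0" for \<omega>
      using that exp_minus_greater[of "- (t * X \<omega> - t * m)"] \<open>t \<noteq> 0\<close> by (simp add: h_eq)
    ultimately have "AE \<omega> in M. X \<omega> = m" by (auto elim: eventually_mono)
    then show False using nonconst by blast
  qed
  then have "0 < integral\<^sup>L M h"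
    using h_nonneg by (simp add: order.strict_iff_order Bochner_Integration.integral_nonneg)
  then have "1 < exp (cgf M X t - t * m)"
    by (simp add: eq exp_diff exp_minus divide_inverse)
  then show ?thesis by (simp add: m_def)
qed

text \<open>Scaling carries the strict Jensen gaps at 1 and -1 out to all larger
  \<open>\<bar>t\<bar>\<close>; the \<open>- 1\<close> makes the bound trivial for
  \<open>\<bar>t\<bar> \<le> 1\<close>.\<close>

lemma cgf_superlinear:
  assumes nonconst: "\<not> (\<exists>c. AE \<omega> in M. X \<omega> = c)"
  shows "\<exists>\<kappa>>0. \<forall>t. \<kappa> * (\<bar>t\<bar> - 1) \<le> cgf M X t - t * expectation X"
proof -
  define m where "m = expectation X"
  define \<kappa> where "\<kappa> = min (cgf M X 1 - m) (cgf M X (- 1) + m)"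
  have "0 < \<kappa>"
    using cgf_gt_mean[OF nonconst, of 1] cgf_gt_mean[OF nonconst, of "- 1"]
    by (simp add: \<kappa>_def m_def)
  moreover have "\<kappa> * (\<bar>t\<bar> - 1) \<le> cgf M X t - t * m" for t
  proof (cases "\<bar>t\<bar> \<le> 1")
    case True
    have "t * m \<le> cgf M X t"
      using cgf_gt_mean[OF nonconst, of t] by (cases "t = 0") (simp_all add: m_def)
    moreover have "\<kappa> * (\<bar>t\<bar> - 1) \<le> 0"
      using True \<open>0 < \<kappa>\<close> by (simp add: mult_nonneg_nonpos)
    ultimately show ?thesis by simp
  next
    case False
    define s where "s = sgn t"
    have s: "t = \<bar>t\<bar> * s" "s = 1 \<or> s = - 1"
      using False by (auto simp: s_def sgn_if)
    have "cgf M X ((1 / \<bar>t\<bar>) * t) \<le> 1 / \<bar>t\<bar> * cgf M X t"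
      using False by (intro cgf_scale) simp_all
    also have "(1 / \<bar>t\<bar>) * t = s" using False by (simp add: s_def sgn_if)
    finally have "\<bar>t\<bar> * cgf M X s \<le> cgf M X t"
      using False by (simp add: field_simps)
    moreover have "\<kappa> \<le> cgf M X s - s * m" using s(2) by (auto simp: \<kappa>_def)
    then have "\<bar>t\<bar> * \<kappa> \<le> \<bar>t\<bar> * (cgf M X s - s * m)" by (rule mult_left_mono) simp
    moreover have "\<bar>t\<bar> * (cgf M X s - s * m) = \<bar>t\<bar> * cgf M X s - t * m"
      using s(1) by (metis mult.assoc right_diff_distrib)
    moreover have "\<kappa> * (\<bar>t\<bar> - 1) = \<bar>t\<bar> * \<kappa> - \<kappa>" by (simp add: algebra_simps)
    ultimately show ?thesis using \<open>0 < \<kappa>\<close> by linarith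
  qed
  ultimately show ?thesis unfolding m_def by blast
qed

end

section \<open>The value under complete information\<close>

text \<open>Firm I's payoff is \<open>gain - E exp (- u (wealth_I - slope \<mu>))\<close> and firm J accepts iff
  \<open>E exp (v (loss_J + (1 - slope) \<mu>)) \<le> 1\<close>.\<close>

fun gain :: "'w contract_data \<Rightarrow> control \<Rightarrow> real" where
  "gain P (Control1 \<alpha> \<beta> \<gamma>) = fn_ba P (a_star P \<beta>)"
| "gain P (Control2 a \<alpha> \<beta> \<gamma>) = fn_F P a"

fun slope :: "control \<Rightarrow> real" where
  "slope (Control1 \<alpha> \<beta> \<gamma>) = \<beta>"
| "slope (Control2 a \<alpha> \<beta> \<gamma>) = \<beta>"

fun wealth_I :: "'w contract_data \<Rightarrow> control \<Rightarrow> real" where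
  "wealth_I P (Control1 \<alpha> \<beta> \<gamma>) =
     fn_bm P (m_star P \<gamma>) - \<gamma> * fn_g P (m_star P \<gamma>) + fn_be P (e_star P \<beta>)
     + \<beta> * fn_phi P (e_star P \<beta>) - \<alpha> + \<beta> * (par_delta P * fn_psi P (a_star P \<beta>))"
| "wealth_I P (Control2 a \<alpha> \<beta> \<gamma>) =
     fn_bm P (m_star P \<gamma>) - \<gamma> * fn_g P (m_star P \<gamma>) + fn_be P (e_star P \<beta>)
     + \<beta> * fn_phi P (e_star P \<beta>) - \<alpha> + \<beta> * (par_delta P * fn_psi P a)"

fun loss_J :: "'w contract_data \<Rightarrow> control \<Rightarrow> real" where
  "loss_J P (Control1 \<alpha> \<beta> \<gamma>) =
     (1 + par_rJ P) * (par_D P + a_star P \<beta>)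
     - (\<alpha> - (\<beta> - 1) * (par_delta P * fn_psi P (a_star P \<beta>) + fn_phi P (e_star P \<beta>))
        - e_star P \<beta> + \<gamma> * fn_g P (m_star P \<gamma>) - m_star P \<gamma>)"
| "loss_J P (Control2 a \<alpha> \<beta> \<gamma>) =
     - (\<alpha> - (\<beta> - 1) * (par_delta P * fn_psi P a + fn_phi P (e_star P \<beta>))
        - e_star P \<beta> + \<gamma> * fn_g P (m_star P \<gamma>) - m_star P \<gamma>)"

text \<open>The perturbation behind both continuity proofs: a higher fee leaves \<beta> and the best
  responses fixed and creates strict slack in the acceptance constraint.\<close>

fun raise_fee :: "real \<Rightarrow> control \<Rightarrow> control" where
  "raise_fee \<epsilon> (Control1 \<alpha> \<beta> \<gamma>) = Control1 (\<alpha> + \<epsilon>) \<beta> \<gamma>"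
| "raise_fee \<epsilon> (Control2 a \<alpha> \<beta> \<gamma>) = Control2 a (\<alpha> + \<epsilon>) \<beta> \<gamma>"

lemma gain_raise_fee [simp]: "gain P (raise_fee \<epsilon> c) = gain P c"
  by (cases c) simp_all

lemma slope_raise_fee [simp]: "slope (raise_fee \<epsilon> c) = slope c"
  by (cases c) simp_all

lemma wealth_I_raise_fee [simp]: "wealth_I P (raise_fee \<epsilon> c) = wealth_I P c - \<epsilon>"
  by (cases c) simp_all

lemma loss_J_raise_fee [simp]: "loss_J P (raise_fee \<epsilon> c) = loss_J P c - \<epsilon>"
  by (cases c) simp_all

lemma raise_fee_controls: "c \<in> controls i \<Longrightarrow> 0 \<le> \<epsilon> \<Longrightarrow> raise_fee \<epsilon> c \<in> controls i"
  by (auto simp: controls_def split: if_splits)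

lemma controls_nonempty: "controls i \<noteq> {}"
proof -
  have "Control1 0 0 0 \<in> controls i \<or> Control2 0 0 0 0 \<in> controls i"
    by (simp add: controls_def)
  then show ?thesis by blast
qed

lemma ereal_divide_pos: "0 < r \<Longrightarrow> 0 \<le> d \<Longrightarrow> 0 < ereal r / ereal d"
  by (cases "d = 0") (auto simp: divide_ereal_def)

lemma value_complete_upper:
  "c \<in> controls i \<Longrightarrow> - crit_J P v c \<le> 1 \<Longrightarrow> ereal (crit_I P c) \<le> value_complete P i v"
  unfolding value_complete_def by (intro SUP_upper) simp

lemma value_complete_less_witness:
  assumes "x < value_complete P i v"
  obtains c where "c \<in> controls i" and "- crit_J P v c \<le> 1" and "x < ereal (crit_I P c)"
  using assms unfolding value_complete_def less_SUP_iff by auto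

section \<open>Exponential form of the criteria and the order of acceptance\<close>

context contract_model
begin

sublocale exp_moments "prob_sp P" "rv_mu P"
  using prob_sp mu_measurable mu_exp_moments
  by (intro exp_moments.intro exp_moments_axioms.intro)

abbreviation "\<Lambda> \<equiv> cgf (prob_sp P) (rv_mu P)"

lemma integral_exp_affine:
  "(\<integral>\<omega>. exp (k + t * rv_mu P \<omega>) \<partial>prob_sp P) = exp (k + \<Lambda> t)"
  by (simp add: exp_add exp_cgf)

lemma crit_I_eq: "crit_I P c = gain P c - exp (\<Lambda> (par_u P * slope c) - par_u P * wealth_I P c)"
proof -
  note * = integral_exp_affine[of "- par_u P * wealth_I P c" "par_u P * slope c"]
  show ?thesis
  proof (cases c)
    case (Control1 \<alpha> \<beta> \<gamma>)
    show ?thesis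
      unfolding Control1 crit_I.simps Let_def
      by (subst Bochner_Integration.integral_cong[OF refl, THEN trans, OF _ *])
        (simp_all add: Control1 algebra_simps)
  next
    case (Control2 a \<alpha> \<beta> \<gamma>)
    show ?thesis
      unfolding Control2 crit_I.simps Let_def
      by (subst Bochner_Integration.integral_cong[OF refl, THEN trans, OF _ *])
        (simp_all add: Control2 algebra_simps)
  qed
qed

lemma crit_J_eq: "- crit_J P v c = exp (v * loss_J P c + \<Lambda> (v * (1 - slope c)))"
proof (cases c)
  case (Control1 \<alpha> \<beta> \<gamma>)
  \<comment> \<open>In Situation 1 the factor before the integral is \<open>exp l\<close>; as
    \<open>loss_J\<close> already contains this debt term, \<open>l\<close> is subtracted inside the
    integral.\<close>
  define l where "l = v * (1 + par_rJ P) * (par_D P + a_star P \<beta>)"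
  note * = integral_exp_affine[of "v * loss_J P c - l" "v * (1 - slope c)"]
  have "- crit_J P v c = exp l * exp (v * loss_J P c - l + \<Lambda> (v * (1 - slope c)))"
    unfolding Control1 crit_J.simps Let_def
    by (subst Bochner_Integration.integral_cong[OF refl, THEN trans, OF _ *])
      (simp_all add: Control1 l_def algebra_simps)
  then show ?thesis by (simp add: exp_add[symmetric])
next
  case (Control2 a \<alpha> \<beta> \<gamma>)
  note * = integral_exp_affine[of "v * loss_J P c" "v * (1 - slope c)"]
  show ?thesis
    unfolding Control2 crit_J.simps Let_def
    by (subst Bochner_Integration.integral_cong[OF refl, THEN trans, OF _ *])
      (simp_all add: Control2 algebra_simps)
qed

lemma accepts_iff: "- 1 \<le> crit_J P v c \<longleftrightarrow> v * loss_J P c + \<Lambda> (v * (1 - slope c)) \<le> 0"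
  using crit_J_eq[of v c] by (smt (verit) exp_le_one_iff)

text \<open>Scaling the exponent at \<open>w\<close> by \<open>v / w\<close> dominates the one at
  \<open>v\<close>: the loss term scales exactly and \<Lambda> by \<open>cgf_scale\<close>.\<close>

lemma accepts_antimono:
  assumes "0 < v" and "v \<le> w" and "- crit_J P w c \<le> 1"
  shows "- crit_J P v c \<le> 1"
proof -
  have "\<Lambda> (v / w * (w * (1 - slope c))) \<le> v / w * \<Lambda> (w * (1 - slope c))"
    using assms by (intro cgf_scale) simp_all
  also have "v / w * (w * (1 - slope c)) = v * (1 - slope c)" using assms by simp
  finally have "v * loss_J P c + \<Lambda> (v * (1 - slope c))
      \<le> v / w * (w * loss_J P c + \<Lambda> (w * (1 - slope c)))"
    using assms by (simp add: distrib_left)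
  also have "\<dots> \<le> 0"
    using assms by (intro mult_nonneg_nonpos) (simp_all add: accepts_iff)
  finally show ?thesis by (simp add: accepts_iff)
qed

section \<open>Bounds on payoffs, wealth and slope\<close>

lemma e_star_nonneg: "0 \<le> e_star P \<beta>"
proof -
  have "0 < 1 / ereal (max (1 - \<beta>) 0)"
    using ereal_divide_pos[of 1 "max (1 - \<beta>) 0"] by (simp add: one_ereal_def)
  then show ?thesis
    unfolding e_star_def
    by (intro inv_deriv_nonneg phi_C1 phi_concave phi_deriv_zero phi_deriv_infty)
qed

lemma m_star_nonneg:
  assumes "0 \<le> \<gamma>"
  shows "0 \<le> m_star P \<gamma>"
proof -
  have "0 < 1 / ereal \<gamma>"
    using ereal_divide_pos[of 1 \<gamma>] assms by (simp add: one_ereal_def)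
  then show ?thesis
    unfolding m_star_def
    by (intro inv_deriv_nonneg g_C1 g_concave g_deriv_zero g_deriv_infty)
qed

lemma a_star_nonneg: "0 \<le> a_star P \<beta>"
proof -
  have "0 < ereal (1 + par_rJ P) / ereal (max (par_delta P * (1 - \<beta>)) 0)"
    using rJ_nonneg by (intro ereal_divide_pos) simp_all
  then show ?thesis
    unfolding a_star_def
    by (intro inv_deriv_nonneg psi_C1 psi_concave psi_deriv_zero psi_deriv_infty)
qed

lemma phi_psi_le:
  assumes "0 \<le> e" and "0 \<le> a"
  shows "fn_phi P e + par_delta P * fn_psi P a \<le> mu_lower P"
proof -
  define d where "d = max (par_delta P) 0"
  have d: "0 \<le> d" "par_delta P \<le> d" by (simp_all add: d_def)
  have "par_delta P * fn_psi P a \<le> d * fn_psi P a"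
    using d(2) psi_nonneg[OF assms(2)] by (rule mult_right_mono)
  then have "ereal (fn_phi P e + par_delta P * fn_psi P a)
      \<le> ereal (fn_phi P e) + ereal d * ereal (fn_psi P a)"
    by simp
  also have "\<dots> \<le> at_infty (fn_phi P) + ereal d * at_infty (fn_psi P)"
    using assms d(1)
    by (intro add_mono ereal_mult_left_mono le_at_infty phi_mono psi_mono) simp_all
  also have "\<dots> < ereal (mu_lower P)" unfolding d_def by (rule phi_psi_infty)
  finally show ?thesis by simp
qed

text \<open>In the difference the transfers cancel: the fee, the \<gamma>-payment and all terms with
  \<beta>. What remains are benefits net of effort costs, \<phi> + \<delta> \<psi>, and in Situation
  1 a debt with favourable sign.\<close>

lemma wealth_I_le_loss_J: "\<exists>C. \<forall>c\<in>controls i. wealth_I P c \<le> loss_J P c + C"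
proof -
  obtain Cm Ce where Cm: "\<And>x. 0 \<le> x \<Longrightarrow> fn_bm P x - x \<le> Cm"
    and Ce: "\<And>x. 0 \<le> x \<Longrightarrow> fn_be P x - x \<le> Ce"
    using concave_minus_id_bounded_above[OF bm_C1 bm_concave bm_deriv_infty]
      concave_minus_id_bounded_above[OF be_C1 be_concave be_deriv_infty] by blast
  have "wealth_I P c \<le> loss_J P c + (Cm + Ce + mu_lower P)" if c: "c \<in> controls i" for c
  proof (cases c)
    case (Control1 \<alpha> \<beta> \<gamma>)
    then have "0 \<le> \<gamma>" using c by (auto simp: controls_def split: if_splits)
    have "wealth_I P c - loss_J P c =
        (fn_bm P (m_star P \<gamma>) - m_star P \<gamma>) + (fn_be P (e_star P \<beta>) - e_star P \<beta>)
        + (fn_phi P (e_star P \<beta>) + par_delta P * fn_psi P (a_star P \<beta>))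
        - (1 + par_rJ P) * (par_D P + a_star P \<beta>)"
      by (simp add: Control1 algebra_simps)
    moreover have "0 \<le> (1 + par_rJ P) * (par_D P + a_star P \<beta>)"
      using rJ_nonneg D_pos a_star_nonneg[of \<beta>] by simp
    ultimately show ?thesis
      using Cm[OF m_star_nonneg[OF \<open>0 \<le> \<gamma>\<close>]] Ce[OF e_star_nonneg[of \<beta>]]
        phi_psi_le[OF e_star_nonneg[of \<beta>] a_star_nonneg[of \<beta>]] by linarith
  next
    case (Control2 a \<alpha> \<beta> \<gamma>)
    then have "0 \<le> \<gamma>" "0 \<le> a" using c by (auto simp: controls_def split: if_splits)
    have "wealth_I P c - loss_J P c =
        (fn_bm P (m_star P \<gamma>) - m_star P \<gamma>) + (fn_be P (e_star P \<beta>) - e_star P \<beta>)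
        + (fn_phi P (e_star P \<beta>) + par_delta P * fn_psi P a)"
      by (simp add: Control2 algebra_simps)
    then show ?thesis
      using Cm[OF m_star_nonneg[OF \<open>0 \<le> \<gamma>\<close>]] Ce[OF e_star_nonneg[of \<beta>]]
        phi_psi_le[OF e_star_nonneg[of \<beta>] \<open>0 \<le> a\<close>] by linarith
  qed
  then show ?thesis by blast
qed

text \<open>\<open>fn_ba P\<close> stays below its finite limit, and the cost in \<open>fn_F\<close>
  is at least \<open>fn_f P 0\<close> because its argument is nonnegative.\<close>

lemma gain_bounded_above: "\<exists>B. \<forall>c\<in>controls i. gain P c \<le> B"
proof -
  obtain B where B: "\<And>a. 0 \<le> a \<Longrightarrow> fn_ba P a \<le> B"
  proof (cases "at_infty (fn_ba P)")
    case (real B)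
    then show ?thesis using le_at_infty[OF ba_mono] that[of B] by simp
  next
    case MInf
    then show ?thesis using le_at_infty[OF ba_mono, of 0] by simp
  qed (use ba_infty in simp)
  have "gain P c \<le> max B (B - fn_f P 0)" if c: "c \<in> controls i" for c
  proof (cases c)
    case (Control1 \<alpha> \<beta> \<gamma>)
    then show ?thesis using B[OF a_star_nonneg[of \<beta>]] by simp
  next
    case (Control2 a \<alpha> \<beta> \<gamma>)
    then have "0 \<le> a" using c by (auto simp: controls_def split: if_splits)
    then have "0 \<le> (1 + par_rI P) * (par_D P + a)" using rI_nonneg D_pos by simp
    then have "fn_f P 0 \<le> fn_f P ((1 + par_rI P) * (par_D P + a))"
      using f_mono by (auto intro: mono_onD)
    then show ?thesis using B[OF \<open>0 \<le> a\<close>] by (simp add: Control2 fn_F_def)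
  qed
  then show ?thesis by blast
qed

definition gain_bound :: "nat \<Rightarrow> real" where
  "gain_bound i = (SOME B. \<forall>c\<in>controls i. gain P c \<le> B)"

lemma gain_le: "c \<in> controls i \<Longrightarrow> gain P c \<le> gain_bound i"
  using someI_ex[OF gain_bounded_above[of i]] unfolding gain_bound_def by blast

text \<open>A lower bound on the payoff thus bounds the exponential term, which keeps the cost of a
  fee increase uniform over near-optimal contracts.\<close>

lemma exp_term_le:
  assumes "c \<in> controls i"
  shows "exp (\<Lambda> (par_u P * slope c) - par_u P * wealth_I P c) \<le> gain_bound i - crit_I P c"
  using gain_le[OF assms] by (simp add: crit_I_eq)

lemma crit_I_le: "c \<in> controls i \<Longrightarrow> crit_I P c \<le> gain_bound i"
  using exp_term_le[of c i] exp_gt_zero[of "\<Lambda> (par_u P * slope c) - par_u P * wealth_I P c"]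
  by linarith

text \<open>The fee multiplies the exponential term by \<open>exp (par_u P * \<epsilon>)\<close>,
  and that term is at most \<open>gain_bound i - x\<close>. The resulting loss depends on
  \<open>c\<close> only through the bound \<open>x\<close>.\<close>

lemma crit_I_raise_fee:
  assumes "c \<in> controls i" and "0 \<le> \<epsilon>" and "x \<le> crit_I P c"
  shows "x - (exp (par_u P * \<epsilon>) - 1) * (gain_bound i - x) \<le> crit_I P (raise_fee \<epsilon> c)"
proof -
  define E where "E = exp (\<Lambda> (par_u P * slope c) - par_u P * wealth_I P c)"
  have "crit_I P (raise_fee \<epsilon> c) = gain P c - E * exp (par_u P * \<epsilon>)"
    by (simp add: crit_I_eq E_def right_diff_distrib flip: exp_add)
  also have "\<dots> = crit_I P c - (exp (par_u P * \<epsilon>) - 1) * E"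
    by (simp add: crit_I_eq E_def algebra_simps)
  finally have "crit_I P (raise_fee \<epsilon> c) = crit_I P c - (exp (par_u P * \<epsilon>) - 1) * E" .
  moreover have "(exp (par_u P * \<epsilon>) - 1) * E \<le> (exp (par_u P * \<epsilon>) - 1) * (gain_bound i - x)"
    using exp_term_le[OF assms(1)] assms u_pos by (intro mult_left_mono) (simp_all add: E_def)
  ultimately show ?thesis using assms(3) by linarith
qed

lemma raise_fee_loss_tendsto:
  "((\<lambda>\<epsilon>. x - (exp (par_u P * \<epsilon>) - 1) * (gain_bound i - x)) \<longlongrightarrow> x) (at_right 0)"
  by (auto intro!: tendsto_eq_intros)

text \<open>Adding the certainty equivalents of the two firms eliminates the fee. Up to a term that is
  bounded above, what remains is \<open>- \<Lambda> (u \<beta>) / u - \<Lambda> (v (1 - \<beta>)) / v\<close>, and by Jensen's inequality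
  this decreases at least linearly in \<open>\<bar>\<beta>\<bar>\<close>.\<close>

lemma slope_bounded:
  "\<exists>R. \<forall>c\<in>controls i. \<forall>v>0. - crit_J P v c \<le> 1 \<longrightarrow> x \<le> crit_I P c \<longrightarrow> \<bar>slope c\<bar> \<le> R"
proof -
  obtain C where C: "\<And>c. c \<in> controls i \<Longrightarrow> wealth_I P c \<le> loss_J P c + C"
    using wealth_I_le_loss_J by blast
  obtain \<kappa> where \<kappa>: "0 < \<kappa>"
    "\<And>t. \<kappa> * (\<bar>t\<bar> - 1) \<le> \<Lambda> t - t * expectation (rv_mu P)"
    using cgf_superlinear[OF mu_nonconst] by blast
  define m where "m = expectation (rv_mu P)"
  define T where "T = ln (gain_bound i - x) + par_u P * (C - m)"
  have "\<bar>slope c\<bar> \<le> (T / \<kappa> + 1) / par_u P"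
    if c: "c \<in> controls i" and v: "0 < v" and acc: "- crit_J P v c \<le> 1" and x: "x \<le> crit_I P c" for c v
  proof -
    define \<beta> where "\<beta> = slope c"
    have *: "exp (\<Lambda> (par_u P * \<beta>) - par_u P * wealth_I P c) \<le> gain_bound i - x"
      using exp_term_le[OF c] x by (simp add: \<beta>_def)
    then have "0 < gain_bound i - x" using exp_gt_zero less_le_trans by blast
    with * have 1: "\<Lambda> (par_u P * \<beta>) - par_u P * wealth_I P c \<le> ln (gain_bound i - x)"
      by (simp add: ln_ge_iff)
    \<comment> \<open>Jensen's inequality for firm J; after division by \<open>v\<close> the
      acceptance condition yields a bound on \<open>loss_J\<close> free of \<open>v\<close>, so one
      bound on the slope serves all risk aversions.\<close>
    have 2: "v * (1 - \<beta>) * m \<le> \<Lambda> (v * (1 - \<beta>))"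
      using cgf_gt_mean[OF mu_nonconst, of "v * (1 - \<beta>)"]
      by (cases "v * (1 - \<beta>) = 0") (auto simp: m_def)
    have "v * (loss_J P c + (1 - \<beta>) * m) = v * loss_J P c + v * (1 - \<beta>) * m"
      by (simp add: algebra_simps)
    also have "\<dots> \<le> 0"
      using acc 2 by (simp add: accepts_iff \<beta>_def)
    finally have "v * (loss_J P c + (1 - \<beta>) * m) \<le> 0" .
    then have "loss_J P c + (1 - \<beta>) * m \<le> 0" using v by (simp add: mult_le_0_iff)
    then have "wealth_I P c \<le> C - (1 - \<beta>) * m" using C[OF c] by linarith
    then have "par_u P * wealth_I P c \<le> par_u P * (C - (1 - \<beta>) * m)"
      using u_pos by (intro mult_left_mono) simp_all
    also have "\<dots> = par_u P * (C - m) + par_u P * \<beta> * m" by (simp add: algebra_simps)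
    finally have "\<kappa> * (\<bar>par_u P * \<beta>\<bar> - 1) \<le> T"
      using 1 \<kappa>(2)[of "par_u P * \<beta>"] unfolding T_def m_def[symmetric] by linarith
    then have "\<bar>par_u P * \<beta>\<bar> \<le> T / \<kappa> + 1" using \<kappa>(1) by (simp add: field_simps)
    then show ?thesis using u_pos by (simp add: \<beta>_def abs_mult field_simps)
  qed
  then show ?thesis by blast
qed

section \<open>Monotonicity, finiteness and continuity of the value\<close>

lemma value_complete_antimono:
  assumes "0 < v" and "v \<le> w"
  shows "value_complete P i w \<le> value_complete P i v"
  unfolding value_complete_def
  by (rule SUP_subset_mono) (use accepts_antimono[OF assms] in auto)

lemma value_complete_le: "value_complete P i v \<le> ereal (gain_bound i)"
  unfolding value_complete_def by (rule SUP_least) (simp add: crit_I_le)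

text \<open>A sufficiently high fee makes any control acceptable, so the supremum is not over the
  empty set; \<open>gain_bound\<close> bounds it above.\<close>

lemma value_complete_real:
  assumes "0 < v"
  shows "\<exists>r. value_complete P i v = ereal r"
proof -
  obtain c where c: "c \<in> controls i" using controls_nonempty by blast
  define \<epsilon> where "\<epsilon> = \<bar>loss_J P c + \<Lambda> (v * (1 - slope c)) / v\<bar>"
  have "v * (loss_J P c - \<epsilon>) + \<Lambda> (v * (1 - slope c))
      = v * ((loss_J P c + \<Lambda> (v * (1 - slope c)) / v) - \<epsilon>)"
    using assms by (simp add: field_simps)
  also have "\<dots> \<le> 0" using assms by (intro mult_nonneg_nonpos) (simp_all add: \<epsilon>_def)
  finally have "ereal (crit_I P (raise_fee \<epsilon> c)) \<le> value_complete P i v"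
    by (intro value_complete_upper raise_fee_controls c) (simp_all add: accepts_iff \<epsilon>_def)
  then show ?thesis
    using value_complete_le[of i v] by (cases "value_complete P i v") auto
qed

text \<open>A small fee increase keeps the payoff of a good contract above \<open>x\<close> and
  makes its acceptance strict at \<open>v\<close>; by continuity of \<Lambda> acceptance persists
  slightly to the right.\<close>

lemma value_complete_right_cont:
  assumes "0 < v" and "x < value_complete P i v"
  shows "\<exists>w>v. x < value_complete P i w"
proof -
  obtain c where c: "c \<in> controls i" "- crit_J P v c \<le> 1" "x < ereal (crit_I P c)"
    using assms(2) by (rule value_complete_less_witness)
  have "((\<lambda>\<epsilon>. ereal (crit_I P c - (exp (par_u P * \<epsilon>) - 1) * (gain_bound i - crit_I P c)))
      \<longlongrightarrow> ereal (crit_I P c)) (at_right 0)"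
    by (intro tendsto_intros raise_fee_loss_tendsto)
  then have "\<forall>\<^sub>F \<epsilon> in at_right 0.
      x < ereal (crit_I P c - (exp (par_u P * \<epsilon>) - 1) * (gain_bound i - crit_I P c))"
    using c(3) by (rule order_tendstoD)
  then have "\<forall>\<^sub>F \<epsilon> in at_right 0. 0 < \<epsilon> \<and>
      x < ereal (crit_I P c - (exp (par_u P * \<epsilon>) - 1) * (gain_bound i - crit_I P c))"
    using eventually_at_right_less by (intro eventually_conj)
  then obtain \<epsilon> where \<epsilon>: "0 < \<epsilon>"
    "x < ereal (crit_I P c - (exp (par_u P * \<epsilon>) - 1) * (gain_bound i - crit_I P c))"
    by (auto dest: eventually_happens)
  have x: "x < ereal (crit_I P (raise_fee \<epsilon> c))"
    using \<epsilon> crit_I_raise_fee[OF c(1), of \<epsilon> "crit_I P c"] by (auto intro: less_le_trans)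
  define h where "h w = w * (loss_J P c - \<epsilon>) + \<Lambda> (w * (1 - slope c))" for w
  have "continuous_on UNIV h"
    unfolding h_def
    by (intro continuous_intros continuous_on_compose2[OF continuous_on_cgf]) auto
  moreover have "h v < 0"
  proof -
    have "h v = v * loss_J P c + \<Lambda> (v * (1 - slope c)) - v * \<epsilon>"
      by (simp add: h_def algebra_simps)
    moreover have "0 < v * \<epsilon>" using assms(1) \<epsilon>(1) by simp
    ultimately show ?thesis using c(2) by (simp add: accepts_iff)
  qed
  ultimately have "\<forall>\<^sub>F w in at_right v. h w < 0"
    by (intro order_tendstoD(2)[of h "h v"])
      (auto simp: continuous_on_def intro: tendsto_within_subset)
  then have "\<forall>\<^sub>F w in at_right v. v < w \<and> h w < 0"
    using eventually_at_right_less by (intro eventually_conj)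
  then obtain w where w: "v < w" "h w < 0" by (auto dest: eventually_happens)
  have "ereal (crit_I P (raise_fee \<epsilon> c)) \<le> value_complete P i w"
    using w(2) \<epsilon>(1) by (intro value_complete_upper raise_fee_controls c(1))
      (simp_all add: accepts_iff h_def)
  then show ?thesis using w(1) x by (auto intro: less_le_trans)
qed

text \<open>The good contract now varies with \<open>w\<close>, but its slope stays in a compact
  interval. By uniform continuity one fee increase \<epsilon> restores acceptance at
  \<open>v\<close> for all \<open>w\<close> close to \<open>v\<close>; then \<epsilon> tends to
  0.\<close>

lemma value_complete_left_cont:
  assumes v: "0 < v" and x: "\<And>w. 0 < w \<Longrightarrow> w < v \<Longrightarrow> ereal x < value_complete P i w"
  shows "ereal x \<le> value_complete P i v"
proof -
  obtain R where R: "\<And>c w. c \<in> controls i \<Longrightarrow> 0 < w \<Longrightarrow> - crit_J P w c \<le> 1 \<Longrightarrow> x \<le> crit_I P c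
      \<Longrightarrow> \<bar>slope c\<bar> \<le> R"
    using slope_bounded[of i x] by blast
  obtain r where r: "value_complete P i v = ereal r" using value_complete_real[OF v] by blast
  have bound: "x - (exp (par_u P * \<epsilon>) - 1) * (gain_bound i - x) \<le> r" if \<epsilon>: "0 < \<epsilon>" for \<epsilon>
  proof -
    \<comment> \<open>The certainty equivalent of \<open>(1 - \<beta>) \<mu>\<close> for firm J as a
      function of risk aversion and slope. The rectangle starts at \<open>v/2\<close> to keep the
      denominator away from 0.\<close>
    define H where "H y = \<Lambda> (fst y * (1 - snd y)) / fst y" for y :: "real \<times> real"
    have "continuous_on ({v/2..v} \<times> {- R..R}) H"
      unfolding H_def using v
      by (intro continuous_intros continuous_on_compose2[OF continuous_on_cgf]) auto
    then have "uniformly_continuous_on ({v/2..v} \<times> {- R..R}) H"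
      by (rule compact_uniformly_continuous) (intro compact_Times compact_Icc)
    then obtain d where d: "0 < d" "\<And>y z. y \<in> {v/2..v} \<times> {- R..R} \<Longrightarrow> z \<in> {v/2..v} \<times> {- R..R}
        \<Longrightarrow> dist z y < d \<Longrightarrow> dist (H z) (H y) < \<epsilon>"
      using \<epsilon> unfolding uniformly_continuous_on_def by metis
    define w where "w = max (v / 2) (v - d / 2)"
    have w: "0 < w" "w < v" "w \<in> {v/2..v}" "\<bar>v - w\<bar> < d"
      using v d(1) by (auto simp: w_def)
    obtain c where c: "c \<in> controls i" "- crit_J P w c \<le> 1" "x < crit_I P c"
      using x[OF w(1,2)] by (auto elim: value_complete_less_witness)
    have "\<bar>slope c\<bar> \<le> R" using R[OF c(1) w(1) c(2)] c(3) by simp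
    then have "dist (H (v, slope c)) (H (w, slope c)) < \<epsilon>"
      using w v by (intro d(2)) (auto simp: dist_Pair_Pair dist_real_def)
    then have "H (v, slope c) < H (w, slope c) + \<epsilon>" by (simp add: dist_real_def)
    moreover have "loss_J P c + H (w, slope c) \<le> 0"
      using c(2) w(1) by (simp add: accepts_iff H_def field_simps)
    ultimately have "v * (loss_J P c - \<epsilon> + H (v, slope c)) \<le> 0"
      using v by (intro mult_nonneg_nonpos) simp_all
    then have "- crit_J P v (raise_fee \<epsilon> c) \<le> 1"
      using v by (simp add: accepts_iff H_def distrib_left)
    then have "ereal (crit_I P (raise_fee \<epsilon> c)) \<le> ereal r"
      using value_complete_upper[of "raise_fee \<epsilon> c" i P v] raise_fee_controls[OF c(1)] \<epsilon> r by simp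
    then show ?thesis
      using crit_I_raise_fee[OF c(1), of \<epsilon> x] c(3) \<epsilon> by simp
  qed
  have "x \<le> r"
    by (rule tendsto_upperbound[OF raise_fee_loss_tendsto[of x i]])
      (use bound eventually_at_right_less[of 0] in \<open>auto elim: eventually_mono\<close>)
  then show ?thesis using r by simp
qed

end

section \<open>The problem with incomplete information\<close>

text \<open>On the left of a point \<open>G\<close> is bounded by its value and \<open>F\<close> is left-continuous, on the right the
  roles are exchanged; hence \<open>F * G\<close> is upper semicontinuous although \<open>G\<close> may jump.\<close>

lemma monotone_product_attains_max:
  fixes F G :: "real \<Rightarrow> real"
  assumes anti: "\<And>v w. 0 < v \<Longrightarrow> v \<le> w \<Longrightarrow> F w \<le> F v"
    and F_bounds: "\<And>v. 0 < v \<Longrightarrow> 0 \<le> F v" "\<And>v. 0 < v \<Longrightarrow> F v \<le> K"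
    and left: "\<And>v x. 0 < v \<Longrightarrow> (\<And>w. 0 < w \<Longrightarrow> w < v \<Longrightarrow> x < F w) \<Longrightarrow> x \<le> F v"
    and mono: "mono G" and right: "\<And>v. continuous (at_right v) G" and G0: "G 0 = 0"
    and pos: "0 < w0" "w0 \<le> b" "0 < F w0 * G w0"
  shows "\<exists>v. 0 < v \<and> v \<le> b \<and> (\<forall>w. 0 < w \<longrightarrow> w \<le> b \<longrightarrow> F w * G w \<le> F v * G v)"
proof -
  have G_nonneg: "0 \<le> G v" if "0 \<le> v" for v using monoD[OF mono that] G0 by simp
  have G_usc: "\<forall>\<^sub>F w in nhds v. G w < y" if "G v < y" for v y
  proof -
    have "\<forall>\<^sub>F w in at_right v. G w < y"
      using right[of v] that by (intro order_tendstoD(2)[of G "G v"]) (simp_all add: continuous_within)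
    then obtain d where d: "v < d" "\<And>w. v < w \<Longrightarrow> w < d \<Longrightarrow> G w < y"
      unfolding eventually_at_right_field by auto
    have "G w < y" if "w \<in> {..<d}" for w
      using d(2)[of w] that monoD[OF mono, of w v] \<open>G v < y\<close> by (cases "v < w") auto
    then show ?thesis using d(1) by (intro eventually_nhds[THEN iffD2] exI[of _ "{..<d}"]) auto
  qed
  have F_usc: "\<forall>\<^sub>F w in nhds v. F w < y" if v: "0 < v" and y: "F v < y" for v y
  proof -
    define x where "x = (F v + y) / 2"
    have x: "F v < x" "x < y" using y by (simp_all add: x_def)
    \<comment> \<open>If \<open>F\<close> exceeded \<open>x\<close> everywhere left of
      \<open>v\<close>, \<open>left\<close> would give \<open>x \<le> F v\<close>. From such a
      \<open>u\<close> on, antitonicity keeps \<open>F\<close> below \<open>y\<close>.\<close>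
    then obtain u where u: "0 < u" "u < v" "F u \<le> x"
      using left[OF v, of x] by (meson not_le)
    have "F w < y" if "w \<in> {u<..}" for w using anti[of u w] u that x by auto
    then show ?thesis using u(2) by (intro eventually_nhds[THEN iffD2] exI[of _ "{u<..}"]) auto
  qed
  define h where "h w = F w * G w" for w
  define S where "S = Sup (h ` {0<..b})"
  have G_le: "G w \<le> G b" if "w \<le> b" for w using monoD[OF mono that] .
  have "h w \<le> K * G b" if "w \<in> {0<..b}" for w
    unfolding h_def using F_bounds[of w] F_bounds(1)[of w0] F_bounds(2)[of w0] that pos G_nonneg[of w] G_le[of w]
    by (intro mult_mono) auto
  then have bdd: "bdd_above (h ` {0<..b})" by (intro bdd_aboveI2)
  have ne: "h ` {0<..b} \<noteq> {}" using pos by auto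
  have h_le: "h w \<le> S" if "0 < w" "w \<le> b" for w
    unfolding S_def using bdd that by (intro cSup_upper) auto
  have S: "0 < S" using h_le[of w0] pos by (simp add: h_def)
  \<comment> \<open>A maximizing sequence is extracted; its limit \<open>v\<close> a priori lies
    only in \<open>{0..b}\<close>, and 0 has to be excluded.\<close>
  have "S \<in> closure (h ` {0<..b})"
    unfolding S_def by (rule closure_contains_Sup[OF ne bdd])
  then obtain t where t: "\<And>n. t n \<in> h ` {0<..b}" "t \<longlonglongrightarrow> S"
    unfolding closure_sequential by auto
  then obtain s where s: "\<And>n. s n \<in> {0<..b}" "\<And>n. t n = h (s n)"
    unfolding image_iff by metis
  have "\<And>n. s n \<in> {0..b}" using s(1) by (simp add: less_imp_le)
  then obtain v f where v: "v \<in> {0..b}" and f: "strict_mono f" "(s \<circ> f) \<longlonglongrightarrow> v"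
    using seq_compactE[OF compact_imp_seq_compact[OF compact_Icc]] by metis
  have lim: "(\<lambda>n. h (s (f n))) \<longlonglongrightarrow> S"
    using LIMSEQ_subseq_LIMSEQ[OF t(2) f(1)] s(2) by (simp add: o_def)
  have ev: "\<forall>\<^sub>F n in sequentially. Q (s (f n))" if "\<forall>\<^sub>F w in nhds v. Q w" for Q
    using eventually_compose_filterlim[OF that f(2)] by (simp add: o_def)
  have G_nonneg_s: "0 \<le> G (s (f n))" and s_pos: "0 < s (f n)" "s (f n) \<le> b" for n
    using G_nonneg[of "s (f n)"] s(1)[of "f n"] by auto
  have G_ev: "\<forall>\<^sub>F n in sequentially. G (s (f n)) < G v + \<epsilon>" if "0 < \<epsilon>" for \<epsilon>
    using that by (intro ev G_usc) simp
  \<comment> \<open>Near 0 the factor \<open>F\<close> stays below \<open>K\<close> while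
    \<open>G\<close> tends to \<open>G 0 = 0\<close>, so the products could not approach
    \<open>S > 0\<close>.\<close>
  have "v \<noteq> 0"
  proof
    assume [simp]: "v = 0"
    have K: "0 \<le> K" using F_bounds[of w0] pos(1) by simp
    have "S \<le> K * \<epsilon>" if \<epsilon>: "0 < \<epsilon>" for \<epsilon>
    proof (rule tendsto_upperbound[OF lim])
      show "\<forall>\<^sub>F n in sequentially. h (s (f n)) \<le> K * \<epsilon>"
        using G_ev[OF \<epsilon>]
      proof eventually_elim
        case (elim n)
        then show ?case
          unfolding h_def using F_bounds[OF s_pos(1)[of n]] G_nonneg_s[of n] K G0 by (intro mult_mono) auto
      qed
    qed simp
    \<comment> \<open>The denominator contains \<open>K + 1\<close> because \<open>K\<close> may be
      0.\<close>
    from this[of "S / (2 * (K + 1))"] have "S \<le> K / (K + 1) * (S / 2)"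
      using S K by (simp add: field_simps)
    also have "\<dots> \<le> 1 * (S / 2)" using S K by (intro mult_right_mono) (simp_all add: divide_le_eq)
    finally show False using S by simp
  qed
  then have v_pos: "0 < v" using v by simp
  have "S \<le> (F v + \<epsilon>) * (G v + \<epsilon>)" if \<epsilon>: "0 < \<epsilon>" for \<epsilon>
  proof (rule tendsto_upperbound[OF lim])
    have "\<forall>\<^sub>F n in sequentially. F (s (f n)) < F v + \<epsilon>"
      using \<epsilon> by (intro ev F_usc v_pos) simp
    with G_ev[OF \<epsilon>] show "\<forall>\<^sub>F n in sequentially. h (s (f n)) \<le> (F v + \<epsilon>) * (G v + \<epsilon>)"
    proof eventually_elim
      case (elim n)
      then show ?case
        unfolding h_def using F_bounds[OF s_pos(1)[of n]] G_nonneg_s[of n] F_bounds(1)[OF v_pos] \<epsilon>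
        by (intro mult_mono) auto
    qed
  qed simp
  moreover have "((\<lambda>\<epsilon>. (F v + \<epsilon>) * (G v + \<epsilon>)) \<longlongrightarrow> F v * G v) (at_right 0)"
    by (auto intro!: tendsto_eq_intros)
  ultimately have "S \<le> F v * G v"
    using eventually_at_right_less[of "0::real"]
    by (intro tendsto_lowerbound[of "\<lambda>\<epsilon>. (F v + \<epsilon>) * (G v + \<epsilon>)" _ "at_right 0"])
      (auto elim: eventually_mono)
  then have "\<forall>w. 0 < w \<longrightarrow> w \<le> b \<longrightarrow> F w * G w \<le> F v * G v"
    using h_le unfolding h_def by fastforce
  then show ?thesis using v_pos v by auto
qed

section \<open>The penalized payoff\<close>

lemma penalized_0 [simp]: "penalized P x 0 = - par_p P"
  by (simp add: penalized_def flip: zero_ereal_def one_ereal_def)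

text \<open>Because infinity times 0 is 0, even an infinite penalty disappears when acceptance is
  certain.\<close>

lemma penalized_1 [simp]: "penalized P x 1 = x"
  by (simp add: penalized_def flip: zero_ereal_def one_ereal_def)

lemma penalized_mono: "x \<le> y \<Longrightarrow> 0 \<le> q \<Longrightarrow> penalized P x q \<le> penalized P y q"
  unfolding penalized_def by (rule ereal_minus_mono[OF ereal_mult_right_mono order_refl]) simp_all

lemma penalized_real:
  "par_p P = ereal p \<Longrightarrow> penalized P (ereal x) q = ereal ((x + p) * q - p)"
  by (simp add: penalized_def algebra_simps)

lemma penalized_infinite_penalty:
  "par_p P = \<infinity> \<Longrightarrow> q < 1 \<Longrightarrow> penalized P (ereal x) q = - \<infinity>"
  by (simp add: penalized_def)

lemma penalized_mono_prob:
  assumes "par_p P \<noteq> - \<infinity>" and "- par_p P \<le> ereal x" and "q \<le> q'" and "q' \<le> 1"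
  shows "penalized P (ereal x) q \<le> penalized P (ereal x) q'"
proof (cases "par_p P")
  case (real p)
  then have "(x + p) * q \<le> (x + p) * q'" using assms by (intro mult_left_mono) simp_all
  then show ?thesis by (simp add: penalized_real[OF real])
next
  case PInf
  have "q < 1 \<or> q = q'" using assms(3,4) by linarith
  then show ?thesis using penalized_infinite_penalty[OF PInf] by auto
qed (use assms in simp)

section \<open>The distribution of the risk aversion\<close>

context contract_model
begin

lemma rv_V_measurable [measurable]: "rv_V P \<in> borel_measurable (prob_sp P)"
  by (rule V_measurable)

sublocale V: real_distribution "distr (prob_sp P) borel (rv_V P)"
  by (rule real_distribution_distr) (rule V_measurable)

lemma V_cdf_eq: "V_cdf P = cdf (distr (prob_sp P) borel (rv_V P))"
  by (auto simp: fun_eq_iff V_cdf_def cdf_def measure_distr intro!: arg_cong[of _ _ prob])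

lemma mono_V_cdf: "mono (V_cdf P)"
  unfolding V_cdf_eq by (intro monoI V.cdf_nondecreasing)

lemma V_cdf_mono: "v \<le> w \<Longrightarrow> V_cdf P v \<le> V_cdf P w"
  by (rule monoD[OF mono_V_cdf])

lemma V_cdf_right_cont: "continuous (at_right v) (V_cdf P)"
  unfolding V_cdf_eq by (rule V.cdf_is_right_cont)

lemma V_cdf_nonneg: "0 \<le> V_cdf P v"
  by (simp add: V_cdf_def)

lemma V_cdf_le_1: "V_cdf P v \<le> 1"
  by (simp add: V_cdf_def)

lemma V_cdf_0: "V_cdf P 0 = 0"
proof -
  have "{\<omega> \<in> space (prob_sp P). rv_V P \<omega> \<le> 0} = {}" using V_pos by force
  then show ?thesis by (simp only: V_cdf_def measure_empty)
qed

lemma V_cdf_pos_witness: "\<exists>v>0. 0 < V_cdf P v"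
proof -
  have "(V_cdf P \<longlongrightarrow> 1) at_top" unfolding V_cdf_eq by (rule V.cdf_lim_at_top_prob)
  then have "\<forall>\<^sub>F v in at_top. 0 < V_cdf P v" by (rule order_tendstoD) simp
  then have "\<forall>\<^sub>F v in at_top. 0 < v \<and> 0 < V_cdf P v"
    using eventually_gt_at_top by (intro eventually_conj)
  then show ?thesis by (auto dest: eventually_happens)
qed

lemma v_low_nonneg: "0 \<le> v_low P"
  unfolding v_low_def using V_cdf_pos_witness by (intro cInf_greatest) auto

lemma v_low_le: "0 < v \<Longrightarrow> 0 < V_cdf P v \<Longrightarrow> v_low P \<le> v"
  unfolding v_low_def by (intro cInf_lower bdd_belowI[of _ 0]) auto

lemma V_cdf_pos:
  assumes "v_low P < v"
  shows "0 < V_cdf P v"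
proof -
  obtain w where "0 < V_cdf P w" "w < v"
    using assms V_cdf_pos_witness unfolding v_low_def by (subst (asm) cInf_less_iff) (auto intro: bdd_belowI[of _ 0])
  then show ?thesis using V_cdf_mono[of w v] by simp
qed

lemma prob_V_greater: "prob {\<omega> \<in> space (prob_sp P). v < rv_V P \<omega>} = 1 - V_cdf P v"
proof -
  have "{\<omega> \<in> space (prob_sp P). v < rv_V P \<omega>}
      = space (prob_sp P) - {\<omega> \<in> space (prob_sp P). rv_V P \<omega> \<le> v}" by auto
  then show ?thesis by (simp add: V_cdf_def prob_compl)
qed

text \<open>Right-continuity of the distribution function is used twice: at 0, to get
  \<open>0 < b\<close>, and at \<open>b\<close>, where the value 1 taken to the right is
  attained.\<close>

lemma v_high_finite:
  assumes "v_high P < \<infinity>"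
  obtains b where "v_high P = ereal b" and "0 < b" and "V_cdf P b = 1"
    and "\<And>v. v < b \<Longrightarrow> V_cdf P v < 1"
proof -
  have high: "v_high P = Sup (ereal ` {v. 0 < v \<and> V_cdf P v < 1})"
    unfolding v_high_def prob_V_greater by simp
  have "\<forall>\<^sub>F v in at_right 0. V_cdf P v < 1"
    using V_cdf_right_cont[of 0] V_cdf_0
    by (intro order_tendstoD(2)[of _ "V_cdf P 0"]) (simp_all add: continuous_within)
  then have "\<forall>\<^sub>F v in at_right 0. 0 < v \<and> V_cdf P v < 1"
    using eventually_at_right_less by (intro eventually_conj)
  then obtain w where w: "0 < w" "V_cdf P w < 1" by (auto dest: eventually_happens)
  then have w_le: "ereal w \<le> v_high P" unfolding high by (intro SUP_upper) simp
  then obtain b where b: "v_high P = ereal b" using assms by (cases "v_high P") auto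
  have "0 < b" using w(1) w_le b by simp
  have eq1: "V_cdf P v = 1" if "b < v" for v
  proof (rule ccontr)
    assume "V_cdf P v \<noteq> 1"
    then have "ereal v \<le> v_high P"
      unfolding high using V_cdf_le_1[of v] that \<open>0 < b\<close> by (intro SUP_upper) simp
    then show False using that b by simp
  qed
  have "(V_cdf P \<longlongrightarrow> V_cdf P b) (at_right b)"
    using V_cdf_right_cont[of b] by (simp add: continuous_within)
  moreover have "\<forall>\<^sub>F v in at_right b. V_cdf P v = 1"
    using eventually_at_right_less by (rule eventually_mono) (rule eq1)
  then have "(V_cdf P \<longlongrightarrow> 1) (at_right b)" by (rule tendsto_eventually)
  ultimately have "V_cdf P b = 1" by (intro tendsto_unique[of "at_right b"]) simp_all
  moreover have "V_cdf P v < 1" if "v < b" for v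
  proof -
    have "ereal v < Sup (ereal ` {v. 0 < v \<and> V_cdf P v < 1})" using that b high by simp
    then obtain w where "v < w" "V_cdf P w < 1" unfolding less_SUP_iff by auto
    then show ?thesis using V_cdf_mono[of v w] by simp
  qed
  ultimately show ?thesis using that b \<open>0 < b\<close> by blast
qed

section \<open>Acceptance probabilities and thresholds\<close>

lemma accept_event_measurable [measurable]:
  "{\<omega> \<in> space (prob_sp P). - crit_J P (rv_V P \<omega>) c \<le> 1} \<in> sets (prob_sp P)"
proof -
  have [measurable]: "\<Lambda> \<in> borel_measurable borel"
    by (rule borel_measurable_continuous_onI[OF continuous_on_cgf])
  show ?thesis by (simp add: crit_J_eq)
qed

lemma V_cdf_le_accept_prob:
  assumes "0 < v" and "- crit_J P v c \<le> 1"
  shows "V_cdf P v \<le> accept_prob P c"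
  unfolding V_cdf_def accept_prob_def
  by (rule finite_measure_mono[OF _ accept_event_measurable])
    (use accepts_antimono[OF _ _ assms(2)] V_pos in auto)

lemma accept_prob_le_1: "accept_prob P c \<le> 1"
  by (simp add: accept_prob_def)

text \<open>The acceptance set is an initial interval of \<open>{0<..}\<close> that is closed by continuity.\<close>

lemma accept_prob_eq_V_cdf:
  assumes "0 < accept_prob P c" and "0 < b" and "V_cdf P b = 1"
  obtains v where "0 < v" and "v \<le> b" and "- crit_J P v c \<le> 1" and "accept_prob P c = V_cdf P v"
proof -
  \<comment> \<open>The cut at \<open>b\<close> makes \<open>A\<close> bounded and loses only a null
    event, since the risk aversion is almost surely at most \<open>b\<close>.\<close>
  define A where "A = {v. 0 < v \<and> v \<le> b \<and> - crit_J P v c \<le> 1}"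
  have AE_le_b: "AE \<omega> in prob_sp P. rv_V P \<omega> \<le> b"
    using assms(3) unfolding V_cdf_def by (subst (asm) prob_Collect_eq_1) simp_all
  have "A \<noteq> {}"
  proof
    assume "A = {}"
    from AE_le_b have "AE \<omega> in prob_sp P. \<not> - crit_J P (rv_V P \<omega>) c \<le> 1"
      by (rule AE_mp) (rule AE_I2, use V_pos \<open>A = {}\<close> in \<open>auto simp: A_def\<close>)
    then have "accept_prob P c = 0"
      unfolding accept_prob_def by (subst prob_Collect_eq_0[OF accept_event_measurable])
    then show False using assms(1) by simp
  qed
  define s where "s = Sup A"
  have bdd: "bdd_above A" by (rule bdd_aboveI[of _ b]) (simp add: A_def)
  have s: "0 < s" "s \<le> b"
    using \<open>A \<noteq> {}\<close> cSup_upper[OF _ bdd] cSup_least[OF \<open>A \<noteq> {}\<close>, of b]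
    unfolding s_def[symmetric] by (force simp: A_def)+
  have upper: "v \<le> s" if "v \<in> A" for v unfolding s_def using that bdd by (rule cSup_upper)
  \<comment> \<open>\<open>A\<close> need not be closed at 0; \<open>T\<close> drops the constraints
    on \<open>v\<close> and is closed, so it contains the supremum of \<open>A\<close>.\<close>
  define T where "T = {v. v * loss_J P c + \<Lambda> (v * (1 - slope c)) \<le> 0}"
  have "closed T"
    unfolding T_def
    by (intro closed_Collect_le continuous_intros continuous_on_compose2[OF continuous_on_cgf]) auto
  moreover have "A \<subseteq> T" by (auto simp: A_def T_def accepts_iff)
  ultimately have "s \<in> T"
    using closure_contains_Sup[OF \<open>A \<noteq> {}\<close> bdd] closure_minimal unfolding s_def by blast
  then have acc: "- crit_J P s c \<le> 1" by (simp add: T_def accepts_iff)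
  have "accept_prob P c \<le> V_cdf P s"
    unfolding accept_prob_def V_cdf_def
  proof (rule finite_measure_mono_AE)
    show "AE \<omega> in prob_sp P. \<omega> \<in> {\<omega> \<in> space (prob_sp P). - crit_J P (rv_V P \<omega>) c \<le> 1}
        \<longrightarrow> \<omega> \<in> {\<omega> \<in> space (prob_sp P). rv_V P \<omega> \<le> s}"
      using AE_le_b by (rule AE_mp) (rule AE_I2, use V_pos upper in \<open>auto simp: A_def\<close>)
  qed simp
  then show ?thesis
    using that[OF s acc] V_cdf_le_accept_prob[OF s(1) acc] by simp
qed

lemma value_complete_tendsto_SUP:
  assumes "0 \<le> a"
  shows "(value_complete P i \<longlongrightarrow> (SUP v\<in>{a<..}. value_complete P i v)) (at_right a)"
proof (rule order_tendstoI)
  fix y assume "y < (SUP v\<in>{a<..}. value_complete P i v)"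
  then obtain w where w: "a < w" "y < value_complete P i w" by (auto simp: less_SUP_iff)
  have "y < value_complete P i v" if "a < v" "v < w" for v
    using value_complete_antimono[of v w i] that w assms by (auto intro: less_le_trans)
  then show "\<forall>\<^sub>F v in at_right a. y < value_complete P i v"
    using w(1) unfolding eventually_at_right_field by blast
next
  fix y assume y: "(SUP v\<in>{a<..}. value_complete P i v) < y"
  show "\<forall>\<^sub>F v in at_right a. value_complete P i v < y"
    using eventually_at_right_less[of a]
    by (rule eventually_mono) (auto intro!: le_less_trans[OF _ y] SUP_upper)
qed

text \<open>A value above the supremum would, by right-continuity, be matched by one strictly to the
  right. The case that matters is \<open>v = v_low P\<close>, which the supremum omits but where the
  distribution may have an atom.\<close>

lemma value_complete_le_limit:
  assumes "0 < v" and "v_low P \<le> v"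
  shows "value_complete P i v \<le> (SUP w\<in>{v_low P<..}. value_complete P i w)"
proof (rule ccontr)
  assume "\<not> ?thesis"
  then obtain w where "v < w" "(SUP w\<in>{v_low P<..}. value_complete P i w) < value_complete P i w"
    using value_complete_right_cont[OF assms(1)] by (auto simp: not_le)
  moreover have "value_complete P i w \<le> (SUP w\<in>{v_low P<..}. value_complete P i w)"
    using \<open>v < w\<close> assms(2) by (intro SUP_upper) simp
  ultimately show False by simp
qed

text \<open>The risk aversion is almost surely at least \<open>v_low P\<close>, so acceptance only
  below that point would have probability 0.\<close>

lemma accept_prob_pos_witness:
  assumes "0 < accept_prob P c"
  obtains v where "0 < v" and "v_low P \<le> v" and "- crit_J P v c \<le> 1"
proof -
  have "V.prob {..<v_low P} = 0"
  proof -
    have "(V_cdf P \<longlongrightarrow> V.prob {..<v_low P}) (at_left (v_low P))"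
      unfolding V_cdf_eq by (rule V.cdf_at_left)
    moreover have "V_cdf P v = 0" if "v < v_low P" for v
      using v_low_le[of v] V_cdf_mono[of v 0] V_cdf_0 V_cdf_nonneg[of v] that
      by (cases "0 < v") fastforce+
    then have "\<forall>\<^sub>F v in at_left (v_low P). V_cdf P v = 0"
      by (simp add: eventually_at_filter)
    then have "(V_cdf P \<longlongrightarrow> 0) (at_left (v_low P))" by (rule tendsto_eventually)
    ultimately show ?thesis by (intro tendsto_unique[of "at_left (v_low P)"]) simp_all
  qed
  then have "prob {\<omega> \<in> space (prob_sp P). rv_V P \<omega> < v_low P} = 0"
    by (simp add: measure_distr vimage_def Int_def conj_commute)
  then have AE: "AE \<omega> in prob_sp P. \<not> rv_V P \<omega> < v_low P"
    by (subst (asm) prob_Collect_eq_0) simp_all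
  have "\<exists>v. 0 < v \<and> v_low P \<le> v \<and> - crit_J P v c \<le> 1"
  proof (rule ccontr)
    assume no: "\<not> ?thesis"
    have "AE \<omega> in prob_sp P. \<not> - crit_J P (rv_V P \<omega>) c \<le> 1"
      using AE by (rule AE_mp) (rule AE_I2, use no in \<open>force simp: not_less dest: V_pos\<close>)
    then have "accept_prob P c = 0"
      unfolding accept_prob_def by (subst prob_Collect_eq_0[OF accept_event_measurable])
    then show False using assms by simp
  qed
  then show ?thesis using that by blast
qed

section \<open>Reduction to the optimization over thresholds\<close>

lemma value_incomplete_no_contract:
  assumes "(SUP v\<in>{v_low P<..}. value_complete P i v) \<le> - par_p P"
  shows "value_incomplete P i = - par_p P"
proof -
  have "payoff_incomplete P c \<le> - par_p P" if c: "c \<in> controls i" for c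
  proof (cases "accept_prob P c = 0")
    case False
    then have "0 < accept_prob P c" by (simp add: accept_prob_def zero_less_measure_iff)
    then obtain v where v: "0 < v" "v_low P \<le> v" "- crit_J P v c \<le> 1"
      by (rule accept_prob_pos_witness)
    have "ereal (crit_I P c) \<le> - par_p P"
      using value_complete_upper[OF c v(3)] value_complete_le_limit[OF v(1,2), of i] assms
      by simp
    \<comment> \<open>An infinite penalty is impossible here, because the real number
      \<open>crit_I P c\<close> is at most \<open>- par_p P\<close>.\<close>
    then obtain p where p: "par_p P = ereal p" "crit_I P c + p \<le> 0"
      using p_range by (cases "par_p P") auto
    then have "(crit_I P c + p) * accept_prob P c \<le> 0"
      by (intro mult_nonpos_nonneg) (simp_all add: accept_prob_def)
    then show ?thesis by (simp add: payoff_incomplete_def penalized_real[OF p(1)] p(1))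
  qed (simp add: payoff_incomplete_def)
  then have "(SUP c\<in>controls i. payoff_incomplete P c) \<le> - par_p P" by (rule SUP_least)
  then show ?thesis by (simp add: value_incomplete_def max_absorb1)
qed

text \<open>At its acceptance threshold \<open>v\<close> a contract is admissible for complete
  information, and its acceptance probability is exactly \<open>V_cdf P v\<close>.\<close>

lemma value_incomplete_le_w_value:
  assumes "v_high P < \<infinity>"
  shows "value_incomplete P i \<le> w_value P i"
proof -
  obtain b where b: "0 < b" "V_cdf P b = 1" using v_high_finite[OF assms] by metis
  have "payoff_incomplete P c \<le> w_value P i" if c: "c \<in> controls i" for c
  proof (cases "accept_prob P c = 0")
    case True
    then show ?thesis by (simp add: payoff_incomplete_def w_value_def)
  next
    case False
    then have "0 < accept_prob P c" by (simp add: accept_prob_def zero_less_measure_iff)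
    then obtain v where v: "0 < v" "- crit_J P v c \<le> 1" "accept_prob P c = V_cdf P v"
      using b by (rule accept_prob_eq_V_cdf)
    have "payoff_incomplete P c \<le> w_objective P i v"
      unfolding payoff_incomplete_def w_objective_def v(3)
      by (intro penalized_mono value_complete_upper c v(2) V_cdf_nonneg)
    also have "\<dots> \<le> w_value P i"
      unfolding w_value_def using v(1) by (intro max.coboundedI2 SUP_upper) simp
    finally show ?thesis .
  qed
  then show ?thesis
    unfolding value_incomplete_def by (auto intro: SUP_least simp: w_value_def)
qed

text \<open>A finite penalty is beaten just right of \<open>v_low P\<close>, where acceptance has
  positive probability; an infinite one at \<open>b\<close>, where acceptance is certain.\<close>

lemma w_value_gt_penalty:
  assumes L: "- par_p P < (SUP v\<in>{v_low P<..}. value_complete P i v)" and "v_high P < \<infinity>"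
  shows "- par_p P < w_value P i"
proof -
  have "\<exists>v>0. - par_p P < w_objective P i v"
  proof (cases "par_p P")
    case (real p)
    obtain v where v: "v_low P < v" "- par_p P < value_complete P i v"
      using L by (auto simp: less_SUP_iff)
    then have "0 < v" using v_low_nonneg by simp
    then obtain r where r: "value_complete P i v = ereal r" using value_complete_real by blast
    have "0 < (r + p) * V_cdf P v" using v(2) r real V_cdf_pos[OF v(1)] by simp
    then show ?thesis
      using \<open>0 < v\<close> real by (intro exI[of _ v]) (simp add: w_objective_def r penalized_real)
  next
    case PInf
    obtain b where b: "0 < b" "V_cdf P b = 1" using v_high_finite[OF assms(2)] by metis
    then show ?thesis
      using value_complete_real[OF b(1), of i] PInf
      by (intro exI[of _ b]) (auto simp: w_objective_def)
  qed (use p_range in simp)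
  then show ?thesis by (auto simp: w_value_def less_max_iff_disj less_SUP_iff)
qed

text \<open>The objective at a solution strictly exceeds \<open>- par_p P\<close>. For finite
  \<open>p\<close> the product \<open>(r + p) * V_cdf P v\<close> is then positive, hence both
  factors are; for infinite \<open>p\<close> any \<open>V_cdf P v < 1\<close> would give minus
  infinity.\<close>

lemma w_solution_properties:
  assumes L: "- par_p P < (SUP v\<in>{v_low P<..}. value_complete P i v)" and fin: "v_high P < \<infinity>"
    and v: "v \<in> w_solutions P i"
  shows "0 < V_cdf P v" and "- par_p P < value_complete P i v"
    and "par_p P = \<infinity> \<Longrightarrow> V_cdf P v = 1"
proof -
  have "0 < v" and obj: "- par_p P < w_objective P i v"
    using v w_value_gt_penalty[OF L fin] by (simp_all add: w_solutions_def)
  then obtain r where r: "value_complete P i v = ereal r" using value_complete_real by blast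
  have *: "0 < V_cdf P v \<and> - par_p P < value_complete P i v \<and> (par_p P = \<infinity> \<longrightarrow> V_cdf P v = 1)"
  proof (cases "par_p P")
    case (real p)
    then have "0 < (r + p) * V_cdf P v"
      using obj by (simp add: w_objective_def r penalized_real)
    then show ?thesis using V_cdf_nonneg[of v] real r by (simp add: zero_less_mult_iff)
  next
    case PInf
    then have "V_cdf P v = 1"
      using obj V_cdf_le_1[of v] penalized_infinite_penalty[OF PInf, of "V_cdf P v" r]
      by (cases "V_cdf P v < 1") (simp_all add: w_objective_def r)
    then show ?thesis using PInf r by simp
  qed (use p_range in simp)
  then show "0 < V_cdf P v" and "- par_p P < value_complete P i v"
    and "par_p P = \<infinity> \<Longrightarrow> V_cdf P v = 1" by blast+
qed

lemma w_solution_exists: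
  assumes L: "- par_p P < (SUP v\<in>{v_low P<..}. value_complete P i v)"
    and high: "v_high P = ereal b" "0 < b" "V_cdf P b = 1"
    and below: "\<And>v. v < b \<Longrightarrow> V_cdf P v < 1"
  shows "\<exists>v. v \<in> w_solutions P i \<and> v \<le> b"
proof -
  have fin: "v_high P < \<infinity>" by (simp add: high)
  \<comment> \<open>Beyond \<open>b\<close> acceptance is already certain and the value only
    decreases, so maximality on \<open>(0, b]\<close> suffices.\<close>
  have reduce: "v \<in> w_solutions P i"
    if v: "0 < v" and max: "\<And>w. 0 < w \<Longrightarrow> w \<le> b \<Longrightarrow> w_objective P i w \<le> w_objective P i v" for v
  proof -
    have "w_objective P i w \<le> w_objective P i v" if "0 < w" for w
    proof (cases "w \<le> b")
      case False
      then have "V_cdf P w = 1" using V_cdf_mono[of b w] V_cdf_le_1[of w] high by simp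
      then have "w_objective P i w \<le> w_objective P i b"
        using value_complete_antimono[of b w i] False high by (simp add: w_objective_def)
      then show ?thesis using max[of b] high by (auto intro: order_trans)
    qed (use that max in simp)
    then have "(SUP w\<in>{0<..}. w_objective P i w) = w_objective P i v"
      using v by (intro antisym SUP_least SUP_upper) simp_all
    then have "w_value P i = max (- par_p P) (w_objective P i v)" by (simp add: w_value_def)
    then show ?thesis
      using v w_value_gt_penalty[OF L fin] by (simp add: w_solutions_def max_def split: if_splits)
  qed
  show ?thesis
  proof (cases "par_p P")
    case (real p)
    define U where "U v = real_of_ereal (value_complete P i v)" for v
    have U: "value_complete P i v = ereal (U v)" if "0 < v" for v
      using value_complete_real[OF that, of i] by (auto simp: U_def)
    have obj: "w_objective P i v = ereal ((U v + p) * V_cdf P v - p)" if "0 < v" for v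
      by (simp add: w_objective_def U[OF that] penalized_real[OF real])
    \<comment> \<open>Truncation at 0 supplies the nonnegative factor that
      \<open>monotone_product_attains_max\<close> requires; it is inactive at the maximizer, where
      the product is positive.\<close>
    define F where "F v = max (U v + p) 0" for v
    obtain w1 where w1: "v_low P < w1" "- par_p P < value_complete P i w1"
      using L by (auto simp: less_SUP_iff)
    have "0 < w1" using w1(1) v_low_nonneg by simp
    define w0 where "w0 = min w1 b"
    have w0: "0 < w0" "w0 \<le> b" using \<open>0 < w1\<close> high by (simp_all add: w0_def)
    have "0 < V_cdf P w0" using V_cdf_pos[OF w1(1)] high by (simp add: w0_def min_def)
    moreover have "- par_p P < value_complete P i w0"
      using w1(2) value_complete_antimono[of w0 w1 i] w0 by (auto simp: w0_def intro: less_le_trans)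
    then have "0 < U w0 + p" using U[OF w0(1)] real by simp
    ultimately have pos: "0 < (U w0 + p) * V_cdf P w0" "0 < F w0 * V_cdf P w0"
      by (simp_all add: F_def)
    have U_anti: "U w \<le> U v" if "0 < v" "v \<le> w" for v w
      using value_complete_antimono[OF that, of i] U[of v] U[of w] that by simp
    have U_left: "x \<le> U v" if "0 < v" "\<And>w. 0 < w \<Longrightarrow> w < v \<Longrightarrow> x < U w" for v x
      using value_complete_left_cont[OF that(1), of x i] U that by simp
    have "\<exists>v. 0 < v \<and> v \<le> b \<and> (\<forall>w. 0 < w \<longrightarrow> w \<le> b \<longrightarrow> F w * V_cdf P w \<le> F v * V_cdf P v)"
    proof (rule monotone_product_attains_max[where K = "max (gain_bound i + p) 0"])
      show "F v \<le> max (gain_bound i + p) 0" if "0 < v" for v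
        using value_complete_le[of i v] U[OF that] by (simp add: F_def)
      show "F w \<le> F v" if "0 < v" "v \<le> w" for v w
        using U_anti[OF that] by (simp add: F_def)
      show "x \<le> F v" if v: "0 < v" and x: "\<And>w. 0 < w \<Longrightarrow> w < v \<Longrightarrow> x < F w" for v x
      proof (cases "x \<le> 0")
        case False
        have "x - p \<le> U v"
          using x False by (intro U_left[OF v]) (fastforce simp: F_def)
        then show ?thesis by (simp add: F_def)
      qed (simp add: F_def)
    qed (use mono_V_cdf V_cdf_right_cont V_cdf_0 w0 pos in \<open>simp_all add: F_def\<close>)
    then obtain v where v: "0 < v" "v \<le> b"
      and max: "\<And>w. 0 < w \<Longrightarrow> w \<le> b \<Longrightarrow> F w * V_cdf P w \<le> F v * V_cdf P v" by blast
    have "0 < F v" using max[OF w0] pos(2) V_cdf_nonneg[of v]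
      by (smt (verit) F_def mult_eq_0_iff)
    then have Fv: "F v = U v + p" by (simp add: F_def)
    have "w_objective P i w \<le> w_objective P i v" if w: "0 < w" "w \<le> b" for w
    proof -
      have "(U w + p) * V_cdf P w \<le> F w * V_cdf P w"
        by (intro mult_right_mono V_cdf_nonneg) (simp add: F_def)
      then show ?thesis using max[OF w] by (simp add: obj w(1) v(1) Fv)
    qed
    then show ?thesis using reduce[OF v(1)] v(2) by blast
  next
    case PInf
    \<comment> \<open>With an infinite penalty every \<open>w < b\<close> is worth minus infinity,
      which leaves \<open>b\<close> itself.\<close>
    have "w_objective P i w \<le> w_objective P i b" if w: "0 < w" "w \<le> b" for w
    proof (cases "w < b")
      case True
      then have "V_cdf P w < 1" by (rule below)
      then show ?thesis
        using value_complete_real[OF w(1), of i] penalized_infinite_penalty[OF PInf]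
        by (auto simp: w_objective_def)
    qed (use w in simp)
    then show ?thesis using reduce[of b] high by blast
  qed (use p_range in simp)
qed

text \<open>The contract is accepted with probability at least \<open>V_cdf P v\<close>, and since
  its payoff exceeds \<open>- par_p P\<close>, more acceptance is only better. So it earns at least
  \<open>w_value P i\<close>, an upper bound for the incomplete information value.\<close>

lemma stackelberg_complete_imp_incomplete:
  assumes L: "- par_p P < (SUP v\<in>{v_low P<..}. value_complete P i v)" and fin: "v_high P < \<infinity>"
    and v: "v \<in> w_solutions P i" and eq: "stackelberg_complete P i v c r"
  shows "stackelberg_incomplete P i (Contract c r)"
proof -
  have c: "c \<in> controls i" "- crit_J P v c \<le> 1" "ereal (crit_I P c) = value_complete P i v"
    "r = best_response P c"
    using eq by (simp_all add: stackelberg_complete_def)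
  have "0 < v" and "w_value P i = w_objective P i v" using v by (simp_all add: w_solutions_def)
  then have "w_value P i = penalized P (ereal (crit_I P c)) (V_cdf P v)"
    by (simp add: w_objective_def c(3))
  also have "\<dots> \<le> payoff_incomplete P c"
    unfolding payoff_incomplete_def
    using w_solution_properties(2)[OF L fin v] V_cdf_le_accept_prob[OF \<open>0 < v\<close> c(2)]
    by (intro penalized_mono_prob p_range accept_prob_le_1) (simp_all add: c(3) less_imp_le)
  finally have "value_incomplete P i \<le> payoff_incomplete P c"
    using value_incomplete_le_w_value[OF fin, of i] by simp
  moreover have "payoff_incomplete P c \<le> value_incomplete P i"
    unfolding value_incomplete_def using c(1) by (intro max.coboundedI2 SUP_upper)
  ultimately show ?thesis using c by simp
qed

end

theorem theorem8:
  fixes P :: "'w contract_data" and i :: nat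
  assumes "contract_model P" and "i \<in> {1, 2}"
  shows "\<exists>L. (value_complete P i \<longlongrightarrow> L) (at_right (v_low P)) \<and>
    (L \<le> - par_p P \<longrightarrow>
       stackelberg_incomplete P i No_Contract \<and> value_incomplete P i = - par_p P) \<and>
    (\<not> L \<le> - par_p P \<and> v_high P < \<infinity> \<longrightarrow>
       (\<exists>v. v \<in> w_solutions P i \<and> 0 < v \<and> v_low P \<le> v \<and> ereal v \<le> v_high P) \<and>
       (\<forall>v. v \<in> w_solutions P i \<and> 0 < v \<and> v_low P \<le> v \<and> ereal v \<le> v_high P \<longrightarrow>
          (par_p P = \<infinity> \<longrightarrow> ereal v = v_high P) \<and>
          (\<forall>c r. stackelberg_complete P i v c r \<longrightarrow>
             stackelberg_incomplete P i (Contract c r))))"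
proof -
  interpret contract_model P by (rule assms(1))
  define L where "L = (SUP v\<in>{v_low P<..}. value_complete P i v)"
  have "(value_complete P i \<longlongrightarrow> L) (at_right (v_low P))"
    unfolding L_def by (rule value_complete_tendsto_SUP[OF v_low_nonneg])
  moreover have "stackelberg_incomplete P i No_Contract \<and> value_incomplete P i = - par_p P"
    if "L \<le> - par_p P"
    using value_incomplete_no_contract that by (simp add: L_def)
  moreover have "(\<exists>v. v \<in> w_solutions P i \<and> 0 < v \<and> v_low P \<le> v \<and> ereal v \<le> v_high P) \<and>
       (\<forall>v. v \<in> w_solutions P i \<and> 0 < v \<and> v_low P \<le> v \<and> ereal v \<le> v_high P \<longrightarrow>
          (par_p P = \<infinity> \<longrightarrow> ereal v = v_high P) \<and>
          (\<forall>c r. stackelberg_complete P i v c r \<longrightarrow>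
             stackelberg_incomplete P i (Contract c r)))"
    if L: "\<not> L \<le> - par_p P" and fin: "v_high P < \<infinity>"
  proof -
    have L: "- par_p P < (SUP v\<in>{v_low P<..}. value_complete P i v)" using L by (simp add: L_def)
    obtain b where b: "v_high P = ereal b" "0 < b" "V_cdf P b = 1"
      and below: "\<And>v. v < b \<Longrightarrow> V_cdf P v < 1"
      using fin by (rule v_high_finite) blast
    have pos: "0 < v" if "v \<in> w_solutions P i" for v using that by (simp add: w_solutions_def)
    obtain v where "v \<in> w_solutions P i" "v \<le> b" using w_solution_exists[OF L b below] by blast
    then have "v \<in> w_solutions P i \<and> 0 < v \<and> v_low P \<le> v \<and> ereal v \<le> v_high P"
      using pos v_low_le w_solution_properties(1)[OF L fin] b(1) by simp
    \<comment> \<open>A solution under an infinite penalty has certain acceptance, which fails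
      strictly below \<open>b\<close>.\<close>
    moreover have "ereal v = v_high P"
      if v: "v \<in> w_solutions P i" "ereal v \<le> v_high P" and "par_p P = \<infinity>" for v
      using w_solution_properties(3)[OF L fin v(1) \<open>par_p P = \<infinity>\<close>] below[of v] v(2) b(1)
      by (cases "v < b") simp_all
    ultimately show ?thesis using stackelberg_complete_imp_incomplete[OF L fin] by blast
  qed
  ultimately show ?thesis by blast
qed

end
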